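(* \textsc{Vertex Cover Reconfiguration} under $k$-$\mathsf{TJ}$ on general graphs $G$ is in $\mathsf{XP}$ when parameterized by $\mu=|S|-k\geq 0$, where $S$ is the initial vertex cover of the instance; that is, there is an algorithm deciding the problem in time $O(|V(G)|^{h(\mu)})$ for some computable function $h$.
   Context: All graphs are finite, simple and undirected. A vertex cover of $G$ is a set of vertices containing at least one endpoint of every edge. For two vertex subsets $A,B$ of $G$ with $|A|=|B|$, $A$ and $B$ are adjacent under $k$-Token Jumping ($k$-$\mathsf{TJ}$) if $|A\triangle B|\le 2k$. \textsc{Vertex Cover Reconfiguration} (VCR) under $k$-$\mathsf{TJ}$: given a graph $G$, two vertex covers $S,T$ of $G$ with $|S|=|T|$, and $k$, decide whether there is a sequence $S=S_0,S_1,\dots,S_\ell=T$ of vertex covers of $G$ in which $S_{i-1}$ and $S_i$ are adjacent under $k$-$\mathsf{TJ}$ for every $i\in\{1,\dots,\ell\}$. *)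

theory Defs
  imports Main
begin

definition simple_graph :: "'a set \<Rightarrow> 'a set set \<Rightarrow> bool" where
  "simple_graph V E \<longleftrightarrow> finite V \<and> (\<forall>e\<in>E. e \<subseteq> V \<and> card e = 2)"

definition vertex_cover :: "'a set \<Rightarrow> 'a set set \<Rightarrow> 'a set \<Rightarrow> bool" where
  "vertex_cover V E A \<longleftrightarrow> A \<subseteq> V \<and> (\<forall>e\<in>E. A \<inter> e \<noteq> {})"

definition TJ_adjacent :: "nat \<Rightarrow> 'a set \<Rightarrow> 'a set \<Rightarrow> bool" where
  "TJ_adjacent k A B \<longleftrightarrow> card A = card B \<and> card (sym_diff A B) \<le> 2 * k"

definition VCR_instance :: "'a set \<Rightarrow> 'a set set \<Rightarrow> 'a set \<Rightarrow> 'a set \<Rightarrow> bool" where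
  "VCR_instance V E S T \<longleftrightarrow>
     simple_graph V E \<and> vertex_cover V E S \<and> vertex_cover V E T \<and> card S = card T"

definition VCR_yes :: "'a set \<Rightarrow> 'a set set \<Rightarrow> 'a set \<Rightarrow> 'a set \<Rightarrow> nat \<Rightarrow> bool" where
  "VCR_yes V E S T k \<longleftrightarrow>
     (\<exists>(l::nat) \<sigma>. \<sigma> 0 = S \<and> \<sigma> l = T \<and> (\<forall>i\<le>l. vertex_cover V E (\<sigma> i)) \<and>
        (\<forall>i\<in>{1..l}. TJ_adjacent k (\<sigma> (i - 1)) (\<sigma> i)))"

text \<open>
  Algorithms are programs of a random access machine with structured control flow.  The memory
  consists of named arrays of natural numbers indexed by the natural numbers; a fixed program
  mentions only finitely many names, so these arrays can be interleaved in a single memory.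

  The cost is uniform: every operator, memory access, test and command costs one step.
  Addition and truncated subtraction are the only arithmetic operations.  Consequently the
  numbers occurring in a run of \<open>t\<close> steps have \<open>O(t)\<close> more bits than those of the input, and the
  model is polynomially equivalent to Turing machines.  Multiplication at unit cost would break
  this.
\<close>

type_synonym state = "string \<Rightarrow> nat \<Rightarrow> nat"

datatype aexp = Num nat | Read string aexp | Plus aexp aexp | Minus aexp aexp

datatype bexp = Less aexp aexp | Neg bexp | Conj bexp bexp

datatype com = Skip | Assign string aexp aexp | Seq com com | Cond bexp com com | While bexp com

primrec aval :: "aexp \<Rightarrow> state \<Rightarrow> nat" where
  "aval (Num m) s = m"
| "aval (Read x a) s = s x (aval a s)"
| "aval (Plus a b) s = aval a s + aval b s"
| "aval (Minus a b) s = aval a s - aval b s"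

primrec bval :: "bexp \<Rightarrow> state \<Rightarrow> bool" where
  "bval (Less a b) s \<longleftrightarrow> aval a s < aval b s"
| "bval (Neg b) s \<longleftrightarrow> \<not> bval b s"
| "bval (Conj b c) s \<longleftrightarrow> bval b s \<and> bval c s"

primrec acost :: "aexp \<Rightarrow> nat" where
  "acost (Num m) = 1"
| "acost (Read x a) = acost a + 1"
| "acost (Plus a b) = acost a + acost b + 1"
| "acost (Minus a b) = acost a + acost b + 1"

primrec bcost :: "bexp \<Rightarrow> nat" where
  "bcost (Less a b) = acost a + acost b + 1"
| "bcost (Neg b) = bcost b + 1"
| "bcost (Conj b c) = bcost b + bcost c + 1"

text \<open>
  \<open>exec c s t s'\<close>: started in state \<open>s\<close>, the program \<open>c\<close> halts after exactly \<open>t\<close> steps in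
  state \<open>s'\<close>.  The command \<open>Assign x a b\<close> stores the value of \<open>b\<close> in cell \<open>a\<close> of the array \<open>x\<close>.
\<close>

inductive exec :: "com \<Rightarrow> state \<Rightarrow> nat \<Rightarrow> state \<Rightarrow> bool" where
  Skip: "exec Skip s 1 s"
| Assign: "exec (Assign x a b) s (acost a + acost b + 1) (s(x := (s x)(aval a s := aval b s)))"
| Seq: "exec c s t s' \<Longrightarrow> exec d s' u s'' \<Longrightarrow> exec (Seq c d) s (t + u) s''"
| CondTrue: "bval b s \<Longrightarrow> exec c s t s' \<Longrightarrow> exec (Cond b c d) s (bcost b + t + 1) s'"
| CondFalse: "\<not> bval b s \<Longrightarrow> exec d s t s' \<Longrightarrow> exec (Cond b c d) s (bcost b + t + 1) s'"
| WhileFalse: "\<not> bval b s \<Longrightarrow> exec (While b c) s (bcost b + 1) s"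
| WhileTrue: "bval b s \<Longrightarrow> exec c s t s' \<Longrightarrow> exec (While b c) s' u s'' \<Longrightarrow>
    exec (While b c) s (bcost b + t + u + 1) s''"

inductive_cases exec_SkipE: "exec Skip s t s'"
inductive_cases exec_AssignE: "exec (Assign x a b) s t s'"
inductive_cases exec_SeqE: "exec (Seq c d) s t s'"
inductive_cases exec_CondE: "exec (Cond b c d) s t s'"
inductive_cases exec_WhileE: "exec (While b c) s t s'"

lemma exec_deterministic:
  assumes "exec c s t s'" and "exec c s u s''"
  shows "u = t \<and> s'' = s'"
  using assms
proof (induction arbitrary: u s'' rule: exec.induct)
  case (Skip s)
  then show ?case by (auto elim: exec_SkipE)
next
  case (Assign x a b s)
  then show ?case by (auto elim: exec_AssignE)
next
  case (Seq c s t s' d u s'')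
  from Seq.prems show ?case
    by (rule exec_SeqE) (metis Seq.IH)
next
  case (CondTrue b s c t s' d)
  from CondTrue.prems show ?case
    by (rule exec_CondE) (metis CondTrue.IH CondTrue.hyps(1) Suc_eq_plus1)+
next
  case (CondFalse b s d t s' c)
  from CondFalse.prems show ?case
    by (rule exec_CondE) (metis CondFalse.IH CondFalse.hyps(1) Suc_eq_plus1)+
next
  case (WhileFalse b s c)
  from WhileFalse.prems show ?case
    by (rule exec_WhileE) (metis WhileFalse.hyps Suc_eq_plus1)+
next
  case (WhileTrue b s c t s' u s'')
  from WhileTrue.prems show ?case
    by (rule exec_WhileE) (metis WhileTrue.IH WhileTrue.hyps(1) Suc_eq_plus1)+
qed

text \<open>
  A finite sequence of numbers is presented to a program in the initial segment of the array
  \<open>in\<close>; all other cells contain 0.  The result is read off cell 0 of the array \<open>out\<close>.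
\<close>

definition input_state :: "nat list \<Rightarrow> state" where
  "input_state xs = (\<lambda>x i. if x = ''in'' \<and> i < length xs then xs ! i else 0)"

definition halts_with :: "com \<Rightarrow> nat list \<Rightarrow> nat \<Rightarrow> nat \<Rightarrow> bool" where
  "halts_with P xs t r \<longleftrightarrow> (\<exists>s. exec P (input_state xs) t s \<and> s ''out'' 0 = r)"

definition computable :: "(nat \<Rightarrow> nat) \<Rightarrow> bool" where
  "computable f \<longleftrightarrow> (\<exists>P. \<forall>m. \<exists>t. halts_with P [m] t (f m))"

text \<open>
  Input graphs have vertex set \<open>{..<n}\<close>.  An instance is encoded as \<open>n\<close>, \<open>k\<close>, the characteristic
  vectors of \<open>S\<close> and \<open>T\<close>, and the adjacency matrix in row-major order.
\<close>

definition VCR_encode :: "nat \<Rightarrow> nat set set \<Rightarrow> nat set \<Rightarrow> nat set \<Rightarrow> nat \<Rightarrow> nat list" where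
  "VCR_encode n E S T k =
     [n, k] @ map (\<lambda>v. of_bool (v \<in> S)) [0..<n] @ map (\<lambda>v. of_bool (v \<in> T)) [0..<n] @
     map (\<lambda>i. of_bool ({i div n, i mod n} \<in> E)) [0..<n * n]"

end

theory Submission
  imports Defs
begin

text \<open>
  Two vertex covers of size \<open>card S\<close> are adjacent iff they share at least \<open>\<mu>\<close> vertices.  So all
  covers of this size that contain a given \<open>\<mu>\<close>-set form a clique, and it suffices to search the
  graph on the at most \<open>n ^ \<mu>\<close> such sets in which \<open>X\<close> and \<open>Y\<close> are linked if some cover of size at
  most \<open>card S\<close> contains \<open>X \<union> Y\<close>.

  If \<open>S \<inter> T\<close> has at least \<open>\<mu>\<close> vertices, the answer is yes.  Otherwise \<open>S \<inter> T\<close> is small and the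
  graph minus \<open>S \<inter> T\<close> is bipartite, with all edges between \<open>S - T\<close> and \<open>T - S\<close>.
  After guessing the part of \<open>S \<inter> T\<close> in the cover, a link is tested by a minimum vertex cover
  computation in a bipartite graph, which an auction carries out in polynomial time.
\<close>

section \<open>Loop programs\<close>

text \<open>The number of covers is not bounded by a power of \<open>n\<close> that depends on
  \<open>mu\<close> alone, so covers cannot be enumerated. The \<open>mu\<close>-sets can, but then
  a link asks for a small vertex cover with prescribed vertices, which is hard on general graphs.
  The two given covers help: \<open>S\<close> and \<open>T\<close> both meet every edge, so an edge
  avoiding \<open>S \<inter> T\<close> has one end in \<open>S - T\<close> and the other in
  \<open>T - S\<close>. Guessing inside \<open>S \<inter> T\<close> costs one more factor
  \<open>n ^ mu\<close>. The yes-case of a large \<open>S \<inter> T\<close> needs no branch in the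
  program: a \<open>mu\<close>-subset of \<open>S \<inter> T\<close> is marked at the start and lies
  in \<open>T\<close>. An auction suits counting loops better than augmenting paths: it only makes
  local array updates, and its progress is a number that never exceeds
  \<open>2 * n * (n + 1)\<close>, so a number of passes fixed in advance is enough. All loop bounds
  are at most \<open>8 * n ^ (mu + 2)\<close>; running time of degree \<open>D\<close> in that
  quantity gives the exponent \<open>D * (mu + 2)\<close>.\<close>

text \<open>
  Structured programs whose only iteration is a counting loop.  \<open>LFor x b c\<close> counts cell 0 of
  \<open>x\<close> up to cell 0 of \<open>b\<close>.  As no loop bound is ever written, such programs terminate and their
  running time is polynomial in the largest loop bound.
\<close>

datatype lcom = LSkip | LAssign string aexp aexp | LSeq lcom lcom (infixr \<open>;;\<close> 60)
  | LCond bexp lcom lcom | LFor string string lcom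

abbreviation Var :: "string \<Rightarrow> aexp" where
  "Var x \<equiv> Read x (Num 0)"

abbreviation LSet :: "string \<Rightarrow> aexp \<Rightarrow> lcom" where
  "LSet x a \<equiv> LAssign x (Num 0) a"

primrec writes :: "lcom \<Rightarrow> string set" where
  "writes LSkip = {}"
| "writes (LAssign x a b) = {x}"
| "writes (c ;; d) = writes c \<union> writes d"
| "writes (LCond b c d) = writes c \<union> writes d"
| "writes (LFor x b c) = insert x (writes c)"

primrec bounds :: "lcom \<Rightarrow> string set" where
  "bounds LSkip = {}"
| "bounds (LAssign x a b) = {}"
| "bounds (c ;; d) = bounds c \<union> bounds d"
| "bounds (LCond b c d) = bounds c \<union> bounds d"
| "bounds (LFor x b c) = insert b (bounds c)"

primrec counters_ok :: "lcom \<Rightarrow> bool" where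
  "counters_ok LSkip \<longleftrightarrow> True"
| "counters_ok (LAssign x a b) \<longleftrightarrow> True"
| "counters_ok (c ;; d) \<longleftrightarrow> counters_ok c \<and> counters_ok d"
| "counters_ok (LCond b c d) \<longleftrightarrow> counters_ok c \<and> counters_ok d"
| "counters_ok (LFor x b c) \<longleftrightarrow> x \<notin> writes c \<and> counters_ok c"

primrec compile :: "lcom \<Rightarrow> com" where
  "compile LSkip = Skip"
| "compile (LAssign x a b) = Assign x a b"
| "compile (c ;; d) = Seq (compile c) (compile d)"
| "compile (LCond b c d) = Cond b (compile c) (compile d)"
| "compile (LFor x b c) = Seq (Assign x (Num 0) (Num 0))
     (While (Less (Var x) (Var b))
       (Seq (compile c) (Assign x (Num 0) (Plus (Var x) (Num 1)))))"

primrec den :: "lcom \<Rightarrow> state \<Rightarrow> state" where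
  "den LSkip s = s"
| "den (LAssign x a b) s = s(x := (s x)(aval a s := aval b s))"
| "den (c ;; d) s = den d (den c s)"
| "den (LCond b c d) s = (if bval b s then den c s else den d s)"
| "den (LFor x b c) s =
     ((\<lambda>s. (den c s)(x := (den c s x)(0 := den c s x 0 + 1))) ^^ s b 0) (s(x := (s x)(0 := 0)))"

text \<open>\<open>B\<close> stands for a common upper bound on all loop bounds. An iteration costs
  6 for the guard and the \<open>While\<close> step and 6 for the increment, hence 12; initialising
  the counter costs 3 and the final failed guard 6, hence 9.\<close>

primrec time_bound :: "lcom \<Rightarrow> nat \<Rightarrow> nat" where
  "time_bound LSkip B = 1"
| "time_bound (LAssign x a b) B = acost a + acost b + 1"
| "time_bound (c ;; d) B = time_bound c B + time_bound d B"
| "time_bound (LCond b c d) B = bcost b + 1 + time_bound c B + time_bound d B"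
| "time_bound (LFor x b c) B = 9 + B * (time_bound c B + 12)"

section \<open>Semantics and running time of loop programs\<close>

lemma den_frame: "y \<notin> writes c \<Longrightarrow> den c s y = s y"
proof (induction c arbitrary: s)
  case (LFor x b c)
  have "((\<lambda>s. (den c s)(x := (den c s x)(0 := den c s x 0 + 1))) ^^ m) s y = s y" for m s
    using LFor by (induction m) auto
  then show ?case using LFor.prems by simp
qed auto

text \<open>Invariant rule. The step receives the frame condition for free, so invariants need to
  mention only the arrays that the body changes.\<close>

lemma den_LFor_induct:
  assumes "x \<notin> writes c" "b \<notin> writes c" "b \<noteq> x"
    and "P 0 (s(x := (s x)(0 := 0)))"
    and step: "\<And>i s'. \<lbrakk>i < s b 0; P i s'; s' x 0 = i;
          \<And>y. y \<noteq> x \<Longrightarrow> y \<notin> writes c \<Longrightarrow> s' y = s y\<rbrakk>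
        \<Longrightarrow> P (Suc i) ((den c s')(x := (den c s' x)(0 := Suc i)))"
  shows "P (s b 0) (den (LFor x b c) s)"
proof -
  define F where "F = (\<lambda>s. (den c s)(x := (den c s x)(0 := den c s x 0 + 1)))"
  define s0 where "s0 = s(x := (s x)(0 := 0))"
  have "P i ((F ^^ i) s0) \<and> (F ^^ i) s0 x 0 = i \<and>
      (\<forall>y. y \<noteq> x \<longrightarrow> y \<notin> writes c \<longrightarrow> (F ^^ i) s0 y = s y)" if "i \<le> s b 0" for i
    using that
  proof (induction i)
    case 0
    have "P 0 s0" using assms(4) unfolding s0_def .
    moreover have "s0 x 0 = 0" "\<And>y. y \<noteq> x \<Longrightarrow> s0 y = s y" by (simp_all add: s0_def)
    ultimately show ?case by simp
  next
    case (Suc i)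
    define s' where "s' = (F ^^ i) s0"
    have IH: "P i s'" "s' x 0 = i" "\<And>y. y \<noteq> x \<Longrightarrow> y \<notin> writes c \<Longrightarrow> s' y = s y"
      using Suc by (auto simp: s'_def)
    have x: "den c s' x = s' x" by (rule den_frame[OF assms(1)])
    have "F s' = (den c s')(x := (den c s' x)(0 := Suc i))"
      using x IH(2) by (simp add: F_def)
    moreover have "P (Suc i) ((den c s')(x := (den c s' x)(0 := Suc i)))"
      by (rule step) (use Suc.prems IH in auto)
    ultimately have "P (Suc i) (F s')" by metis
    moreover have "F s' x 0 = Suc i" "\<And>y. y \<noteq> x \<Longrightarrow> y \<notin> writes c \<Longrightarrow> F s' y = s y"
      using IH by (simp_all add: F_def den_frame assms(1))
    ultimately show ?case by (simp flip: s'_def)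
  qed
  from this[of "s b 0"] show ?thesis by (simp add: F_def s0_def)
qed

text \<open>\<open>den\<close> reads a loop bound once, whereas the compiled \<open>While\<close>
  rereads it before every iteration. The two agree because no bound and no counter is written in the
  loop body; for the same reason \<open>B\<close> stays valid throughout.\<close>

lemma exec_compile:
  assumes "counters_ok c" "bounds c \<inter> writes c = {}" "\<And>b. b \<in> bounds c \<Longrightarrow> s b 0 \<le> B"
  shows "\<exists>t \<le> time_bound c B. exec (compile c) s t (den c s)"
  using assms
proof (induction c arbitrary: s)
  case LSkip
  show ?case using exec.Skip[of s] by auto
next
  case (LAssign x a b)
  have "exec (compile (LAssign x a b)) s (acost a + acost b + 1) (den (LAssign x a b) s)"
    unfolding compile.simps den.simps by (rule exec.Assign)
  then show ?case unfolding time_bound.simps by blast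
next
  case (LSeq c d)
  obtain t where t: "t \<le> time_bound c B" "exec (compile c) s t (den c s)"
    using LSeq.IH(1)[of s] LSeq.prems by auto
  have "\<And>b. b \<in> bounds d \<Longrightarrow> den c s b 0 \<le> B"
    using LSeq.prems by (subst den_frame) auto
  then obtain u where u: "u \<le> time_bound d B" "exec (compile d) (den c s) u (den d (den c s))"
    using LSeq.IH(2)[of "den c s"] LSeq.prems by auto
  have "exec (compile (c ;; d)) s (t + u) (den (c ;; d) s)"
    using exec.Seq[OF t(2) u(2)] by simp
  then show ?case using t(1) u(1) by (intro exI[of _ "t + u"]) auto
next
  case (LCond b c d)
  show ?case
  proof (cases "bval b s")
    case True
    obtain t where t: "t \<le> time_bound c B" "exec (compile c) s t (den c s)"
      using LCond.IH(1)[of s] LCond.prems by auto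
    then show ?thesis using True exec.CondTrue[of b s "compile c" t "den c s" "compile d"]
      by (intro exI[of _ "bcost b + t + 1"]) auto
  next
    case False
    obtain t where t: "t \<le> time_bound d B" "exec (compile d) s t (den d s)"
      using LCond.IH(2)[of s] LCond.prems by auto
    then show ?thesis using False exec.CondFalse[of b s "compile d" t "den d s" "compile c"]
      by (intro exI[of _ "bcost b + t + 1"]) auto
  qed
next
  case (LFor x b c)
  define F where "F = (\<lambda>s. (den c s)(x := (den c s x)(0 := den c s x 0 + 1)))"
  define s0 where "s0 = s(x := (s x)(0 := 0))"
  define S where "S i = (F ^^ i) s0" for i
  define W where "W = While (Less (Var x) (Var b))
    (Seq (compile c) (Assign x (Num 0) (Plus (Var x) (Num 1))))"
  let ?m = "s b 0"
  have xw: "x \<notin> writes c" and bx: "b \<noteq> x" "b \<notin> writes c" using LFor.prems by auto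
  have fr: "F s' y = s' y" if "y \<noteq> x" "y \<notin> writes c" for s' y
    using that by (simp add: F_def den_frame)
  have Fx: "F s' x 0 = Suc (s' x 0)" for s'
    by (simp add: F_def den_frame[OF xw])
  have Sx: "S i x 0 = i" for i
    by (induction i) (simp_all add: S_def s0_def Fx)
  have Sy: "S i y = s y" if "y \<noteq> x" "y \<notin> writes c" for i y
    using that by (induction i) (simp_all add: S_def s0_def fr)
  \<comment> \<open>Induction on the number \<open>j\<close> of iterations still to come, since a
    run of \<open>While\<close> is assembled from its end.\<close>
  have loop: "\<exists>t \<le> 6 + j * (time_bound c B + 12). exec W (S (?m - j)) t (S ?m)" if "j \<le> ?m" for j
    using that
  proof (induction j)
    case 0
    have "\<not> bval (Less (Var x) (Var b)) (S ?m)" using Sx Sy[OF bx] by simp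
    from exec.WhileFalse[OF this] have "exec W (S ?m) 6 (S ?m)"
      by (simp add: W_def eval_nat_numeral)
    then show ?case by (intro exI[of _ 6]) simp
  next
    case (Suc j)
    let ?i = "?m - Suc j"
    have i: "Suc ?i = ?m - j" "?i < ?m" using Suc.prems by auto
    have g: "bval (Less (Var x) (Var b)) (S ?i)" using Sx Sy[OF bx] i by simp
    have "\<And>b. b \<in> bounds c \<Longrightarrow> S ?i b 0 \<le> B"
      using LFor.prems by (subst Sy) auto
    then obtain t where t: "t \<le> time_bound c B" "exec (compile c) (S ?i) t (den c (S ?i))"
      using LFor.IH[of "S ?i"] LFor.prems by auto
    have a: "exec (Assign x (Num 0) (Plus (Var x) (Num 1))) (den c (S ?i)) 6 (F (S ?i))"
      using exec.Assign[of x "Num 0" "Plus (Var x) (Num 1)" "den c (S ?i)"]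
      by (simp add: F_def eval_nat_numeral)
    obtain u where u: "u \<le> 6 + j * (time_bound c B + 12)" "exec W (S (?m - j)) u (S ?m)"
      using Suc by auto
    have "F (S ?i) = S (?m - j)" by (simp add: S_def flip: i(1))
    then have "exec W (S ?i) (bcost (Less (Var x) (Var b)) + (t + 6) + u + 1) (S ?m)"
      using exec.WhileTrue[OF g exec.Seq[OF t(2) a]] u(2) unfolding W_def by metis
    then show ?case using t(1) u(1)
      by (intro exI[of _ "bcost (Less (Var x) (Var b)) + (t + 6) + u + 1"]) auto
  qed
  obtain t where t: "t \<le> 6 + ?m * (time_bound c B + 12)" "exec W (S 0) t (S ?m)"
    using loop[of ?m] by auto
  have "exec (Assign x (Num 0) (Num 0)) s 3 (S 0)"
    using exec.Assign[of x "Num 0" "Num 0" s] by (simp add: S_def s0_def eval_nat_numeral)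
  from exec.Seq[OF this t(2)]
  have "exec (compile (LFor x b c)) s (3 + t) (den (LFor x b c) s)"
    by (simp add: W_def S_def s0_def F_def)
  moreover have "?m * (time_bound c B + 12) \<le> B * (time_bound c B + 12)"
    using LFor.prems(3)[of b] by (intro mult_right_mono) auto
  then have "3 + t \<le> time_bound (LFor x b c) B" using t(1) unfolding time_bound.simps by linarith
  ultimately show ?case by blast
qed

lemma time_bound_poly: "\<exists>K D. \<forall>B\<ge>1. time_bound c B \<le> K * B ^ D"
proof (induction c)
  case LSkip
  show ?case by (rule exI[of _ 1], rule exI[of _ 0]) simp
next
  case (LAssign x a b)
  show ?case by (rule exI[of _ "acost a + acost b + 1"], rule exI[of _ 0]) simp
next
  case (LSeq c d)
  then obtain K D K' D' where *: "\<And>B. B \<ge> 1 \<Longrightarrow> time_bound c B \<le> K * B ^ D"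
    "\<And>B. B \<ge> 1 \<Longrightarrow> time_bound d B \<le> K' * B ^ D'" by blast
  have "time_bound (c ;; d) B \<le> (K + K') * B ^ (D + D')" if "B \<ge> 1" for B
  proof -
    have "B ^ D \<le> B ^ (D + D')" "B ^ D' \<le> B ^ (D + D')"
      using that by (simp_all add: power_increasing)
    then have "K * B ^ D \<le> K * B ^ (D + D')" "K' * B ^ D' \<le> K' * B ^ (D + D')"
      using mult_le_mono2 by blast+
    then show ?thesis using *[OF that] unfolding time_bound.simps add_mult_distrib by linarith
  qed
  then show ?case by blast
next
  case (LCond b c d)
  then obtain K D K' D' where *: "\<And>B. B \<ge> 1 \<Longrightarrow> time_bound c B \<le> K * B ^ D"
    "\<And>B. B \<ge> 1 \<Longrightarrow> time_bound d B \<le> K' * B ^ D'" by blast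
  have "time_bound (LCond b c d) B \<le> (K + K' + (bcost b + 1)) * B ^ (D + D')" if "B \<ge> 1" for B
  proof -
    have "B ^ D \<le> B ^ (D + D')" "B ^ D' \<le> B ^ (D + D')" "1 \<le> B ^ (D + D')"
      using that by (simp_all add: power_increasing)
    then have "K * B ^ D \<le> K * B ^ (D + D')" "K' * B ^ D' \<le> K' * B ^ (D + D')"
      "(bcost b + 1) * 1 \<le> (bcost b + 1) * B ^ (D + D')"
      using mult_le_mono2 by blast+
    then show ?thesis using *[OF that] unfolding time_bound.simps add_mult_distrib by linarith
  qed
  then show ?case by blast
next
  case (LFor x b c)
  then obtain K D where *: "\<And>B. B \<ge> 1 \<Longrightarrow> time_bound c B \<le> K * B ^ D" by blast
  \<comment> \<open>21 = 12 + 9: for \<open>B \<ge> 1\<close> the one-time cost 9 is at most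
    \<open>B * 9\<close> and can be charged to the iterations.\<close>
  have "time_bound (LFor x b c) B \<le> (K + 21) * B ^ Suc D" if "B \<ge> 1" for B
  proof -
    have "1 \<le> B ^ D" using that by simp
    then have "time_bound c B + 21 \<le> (K + 21) * B ^ D"
      using *[OF that] by (simp add: add_mult_distrib)
    then have "B * (time_bound c B + 21) \<le> B * ((K + 21) * B ^ D)" by simp
    moreover have "9 \<le> B * 9" using that by simp
    ultimately show ?thesis by (simp add: algebra_simps)
  qed
  then show ?case by blast
qed

section \<open>Auctions and vertex covers of bipartite graphs\<close>

definition edge_cover :: "(nat \<Rightarrow> nat \<Rightarrow> bool) \<Rightarrow> nat set \<Rightarrow> bool" where
  "edge_cover Ed C \<longleftrightarrow> finite C \<and> (\<forall>l r. Ed l r \<longrightarrow> l \<in> C \<or> r \<in> C)"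

text \<open>
  Left vertices \<open>l\<close> offer \<open>q l\<close> for a right neighbour, right vertices \<open>r\<close> have price \<open>p r\<close>.
  The owner of \<open>r\<close> is encoded as \<open>ow r = Suc l\<close>, and \<open>mt l > 0\<close> says that \<open>l\<close> owns a vertex.
\<close>

definition auction :: "nat \<Rightarrow> (nat \<Rightarrow> nat \<Rightarrow> bool) \<Rightarrow> (nat \<Rightarrow> nat) \<Rightarrow> (nat \<Rightarrow> nat) \<Rightarrow> (nat \<Rightarrow> nat)
    \<Rightarrow> (nat \<Rightarrow> nat) \<Rightarrow> bool" where
  "auction n Ed p q ow mt \<longleftrightarrow>
     (\<forall>l r. Ed l r \<longrightarrow> q l \<le> p r) \<and>
     (\<forall>r<n. 0 < ow r \<longrightarrow> Ed (ow r - 1) r \<and> 0 < mt (ow r - 1) \<and> p r = Suc (q (ow r - 1))) \<and>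
     (\<forall>l<n. 0 < mt l \<longrightarrow> (\<exists>r<n. ow r = Suc l)) \<and>
     (\<forall>r<n. \<forall>r'<n. 0 < ow r \<longrightarrow> ow r = ow r' \<longrightarrow> r = r') \<and>
     (\<forall>r<n. 0 < p r \<longrightarrow> 0 < ow r) \<and>
     (\<forall>v<n. p v \<le> Suc n \<and> q v \<le> Suc n)"

text \<open>\<open>n < q l\<close> means that \<open>l\<close> has given up. The threshold comes
  from the pigeonhole argument in \<open>settled_cover\<close>: \<open>n\<close> prices cannot fill
  the levels \<open>1, ..., n + 1\<close>, and a vertex that has given up offers at least as much as
  any of these levels.\<close>

definition settled :: "nat \<Rightarrow> (nat \<Rightarrow> nat \<Rightarrow> bool) \<Rightarrow> (nat \<Rightarrow> nat) \<Rightarrow> (nat \<Rightarrow> nat) \<Rightarrow> bool" where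
  "settled n Ed q mt \<longleftrightarrow> (\<forall>l r. Ed l r \<longrightarrow> 0 < mt l \<or> n < q l)"

lemma auction_init:
  assumes "\<And>v. v < n \<Longrightarrow> p v = 0 \<and> q v = 0 \<and> ow v = 0 \<and> mt v = 0"
    and "\<And>l r. Ed l r \<Longrightarrow> l < n \<and> r < n"
  shows "auction n Ed p q ow mt"
  unfolding auction_def using assms(1) by (auto dest: assms(2))

text \<open>Neighbouring prices are at least \<open>q l\<close> and differ from it, hence leave room
  for one more unit. The equations between prices and offers concern only owners, and the unmatched
  \<open>l\<close> is not one.\<close>

lemma auction_relabel:
  assumes "auction n Ed p q ow mt" "mt l = 0" "q l \<le> n" "\<And>r. Ed l r \<Longrightarrow> p r \<noteq> q l"
  shows "auction n Ed p (q(l := Suc (q l))) ow mt"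
proof -
  have "\<And>r. Ed l r \<Longrightarrow> Suc (q l) \<le> p r"
    using assms(1,4) unfolding auction_def by (metis Suc_leI le_neq_implies_less)
  then show ?thesis
    using assms(1-3) unfolding auction_def by (auto split: if_splits)
qed

text \<open>Prices only rise, so no offer comes to exceed a neighbouring price, and a vertex once
  sold stays sold. The new price \<open>Suc (q l)\<close> respects the cap because
  \<open>q l \<le> n\<close>. A displaced owner merely becomes unmatched and keeps its
  offer.\<close>

lemma auction_take:
  assumes inv: "auction n Ed p q ow mt" and l: "mt l = 0" "q l \<le> n" "Ed l r" "p r = q l"
    and bip: "\<And>l r. Ed l r \<Longrightarrow> l < n \<and> r < n"
  shows "auction n Ed (p(r := Suc (p r))) q (ow(r := Suc l))
    ((if 0 < ow r then mt(ow r - 1 := 0) else mt)(l := 1))"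
proof -
  let ?mt = "(if 0 < ow r then mt(ow r - 1 := 0) else mt)(l := 1)"
  have i1: "\<And>l r. Ed l r \<Longrightarrow> q l \<le> p r"
    and i2: "\<And>r. r < n \<Longrightarrow> 0 < ow r \<Longrightarrow>
      Ed (ow r - 1) r \<and> 0 < mt (ow r - 1) \<and> p r = Suc (q (ow r - 1))"
    and i3: "\<And>l. l < n \<Longrightarrow> 0 < mt l \<Longrightarrow> \<exists>r<n. ow r = Suc l"
    and i4: "\<And>r r'. r < n \<Longrightarrow> r' < n \<Longrightarrow> 0 < ow r \<Longrightarrow> ow r = ow r' \<Longrightarrow> r = r'"
    and i5: "\<And>r. r < n \<Longrightarrow> 0 < p r \<Longrightarrow> 0 < ow r"
    and i6: "\<And>v. v < n \<Longrightarrow> p v \<le> Suc n \<and> q v \<le> Suc n"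
    using inv unfolding auction_def by blast+
  have rn: "r < n" "l < n" using bip[OF l(3)] by auto
  \<comment> \<open>Owners have positive \<open>mt\<close>, so the unmatched \<open>l\<close> owns
    nothing yet; this keeps ownership injective after the update.\<close>
  have own: "ow r' \<noteq> Suc l" if "r' < n" for r'
    using i2[OF that] l(1) by auto
  have "0 < ?mt (ow r' - 1)" if r': "r' < n" "r' \<noteq> r" "0 < ow r'" for r'
  proof -
    have "ow r' \<noteq> ow r" using i4[OF r'(1) rn(1)] r' by auto
    then have "0 < ow r \<Longrightarrow> ow r' - 1 \<noteq> ow r - 1" using r'(3) by linarith
    then show ?thesis using i2[OF r'(1,3)] by auto
  qed
  moreover have "\<exists>r'<n. (ow(r := Suc l)) r' = Suc l'" if l': "l' < n" "0 < ?mt l'" for l'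
  proof (cases "l' = l")
    case True
    then show ?thesis using rn by auto
  next
    case False
    then have m: "0 < mt l'" "0 < ow r \<Longrightarrow> l' \<noteq> ow r - 1" using l'(2) by (auto split: if_splits)
    then obtain r' where r': "r' < n" "ow r' = Suc l'" using i3[OF l'(1)] by auto
    then have "r' \<noteq> r" using m(2) by auto
    then show ?thesis using r' by auto
  qed
  moreover have "r1 = r2" if "r1 < n" "r2 < n" "0 < (ow(r := Suc l)) r1"
    "(ow(r := Suc l)) r1 = (ow(r := Suc l)) r2" for r1 r2
    using that i4[of r1 r2] own[of r1] own[of r2] by (auto split: if_splits)
  moreover have "Ed ((ow(r := Suc l)) r' - 1) r' \<and> (p(r := Suc (p r))) r' = Suc (q ((ow(r := Suc l)) r' - 1))"
    if "r' < n" "0 < (ow(r := Suc l)) r'" for r'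
    using that i2[of r'] l by (cases "r' = r") auto
  moreover have "q l' \<le> (p(r := Suc (p r))) r'" if "Ed l' r'" for l' r'
    using i1[OF that] by (cases "r' = r") auto
  moreover have "(p(r := Suc (p r))) v \<le> Suc n \<and> q v \<le> Suc n" if "v < n" for v
    using i6[OF that] l by (cases "v = r") auto
  moreover have "0 < (ow(r := Suc l)) v" if "v < n" "0 < (p(r := Suc (p r))) v" for v
    using i5[of v] that by (cases "v = r") auto
  moreover have "0 < ?mt ((ow(r := Suc l)) r' - 1)" if "r' < n" "0 < (ow(r := Suc l)) r'" for r'
    using that calculation(1)[of r'] by (cases "r' = r") auto
  ultimately show ?thesis
    unfolding auction_def by blast
qed


text \<open>
  Some level \<open>j\<close> is not a price.  The right vertices with higher prices and the left vertices with
  lower offers form a cover, and each of them is charged to an owned right vertex.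
\<close>

lemma settled_cover:
  assumes inv: "auction n Ed p q ow mt" and fin: "settled n Ed q mt"
    and bip: "\<And>l r. Ed l r \<Longrightarrow> l < n \<and> r < n"
  shows "\<exists>C. edge_cover Ed C \<and> C \<subseteq> {v. \<exists>w. Ed v w \<or> Ed w v} \<and> card C \<le> card {r. r < n \<and> 0 < ow r}"
proof -
  have i1: "\<And>l r. Ed l r \<Longrightarrow> q l \<le> p r"
    and i2: "\<And>r. r < n \<Longrightarrow> 0 < ow r \<Longrightarrow>
      Ed (ow r - 1) r \<and> 0 < mt (ow r - 1) \<and> p r = Suc (q (ow r - 1))"
    and i3: "\<And>l. l < n \<Longrightarrow> 0 < mt l \<Longrightarrow> \<exists>r<n. ow r = Suc l"
    and i5: "\<And>r. r < n \<Longrightarrow> 0 < p r \<Longrightarrow> 0 < ow r"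
    using inv unfolding auction_def by blast+
  \<comment> \<open>Pigeonhole: \<open>n\<close> prices miss one of the \<open>n + 1\<close>
    positive levels.\<close>
  have "card (p ` {..<n}) \<le> n" using card_image_le[of "{..<n}" p] by simp
  then have "\<not> {1..Suc n} \<subseteq> p ` {..<n}"
    using card_mono[of "p ` {..<n}" "{1..Suc n}"] by auto
  then obtain j where j': "j \<in> {1..Suc n}" "j \<notin> p ` {..<n}" by blast
  then have j: "j \<le> Suc n" "\<And>r. r < n \<Longrightarrow> p r \<noteq> j" by auto
  define CR where "CR = {r. r < n \<and> j < p r}"
  define CL where "CL = {l. q l < j \<and> (\<exists>r. Ed l r)}"
  define O1 where "O1 = {r. r < n \<and> 0 < ow r \<and> j < p r}"
  define O2 where "O2 = {r. r < n \<and> 0 < ow r \<and> p r < j}"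
  have "CR = O1" using i5 by (auto simp: CR_def O1_def)
  have sub: "CL \<subseteq> (\<lambda>r. ow r - 1) ` O2"
  proof
    fix l assume "l \<in> CL"
    then obtain r where r: "q l < j" "Ed l r" by (auto simp: CL_def)
    then have "0 < mt l" using fin j(1) unfolding settled_def by fastforce
    then obtain r' where r': "r' < n" "ow r' = Suc l" using i3 bip[OF r(2)] by blast
    then have "p r' = Suc (q l)" using i2[of r'] by auto
    \<comment> \<open>\<open>Suc (q l) \<le> j\<close>, and equality is excluded because
      \<open>j\<close> is not a price.\<close>
    then have "p r' < j" using r(1) j(2)[OF r'(1)] by linarith
    then have "r' \<in> O2" using r' by (auto simp: O2_def)
    then show "l \<in> (\<lambda>r. ow r - 1) ` O2" using r' by force
  qed
  have fin: "finite O1" "finite O2" by (auto simp: O1_def O2_def)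
  have "card CL \<le> card O2"
    using surj_card_le[OF fin(2) sub] .
  moreover have "card O1 + card O2 \<le> card {r. r < n \<and> 0 < ow r}"
  proof -
    have "O1 \<inter> O2 = {}" by (auto simp: O1_def O2_def)
    from card_Un_disjoint[OF fin this] show ?thesis
      using card_mono[of "{r. r < n \<and> 0 < ow r}" "O1 \<union> O2"] by (auto simp: O1_def O2_def)
  qed
  moreover have "card (CL \<union> CR) \<le> card CL + card CR" by (rule card_Un_le)
  ultimately have "card (CL \<union> CR) \<le> card {r. r < n \<and> 0 < ow r}" using \<open>CR = O1\<close> by simp
  moreover have "edge_cover Ed (CL \<union> CR)"
    unfolding edge_cover_def
  proof (intro conjI allI impI)
    show "finite (CL \<union> CR)" using \<open>CR = O1\<close> fin sub by (auto intro: finite_subset)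
  next
    fix l r assume e: "Ed l r"
    show "l \<in> CL \<union> CR \<or> r \<in> CL \<union> CR"
      using i1[OF e] j(2)[of r] bip[OF e] e by (cases "p r < j") (auto simp: CL_def CR_def)
  qed
  moreover have "CR \<subseteq> {v. \<exists>w. Ed v w \<or> Ed w v}" 
  proof
    fix r assume "r \<in> CR"
    then have r: "r < n" "0 < p r" by (auto simp: CR_def)
    show "r \<in> {v. \<exists>w. Ed v w \<or> Ed w v}" using i2[OF r(1) i5[OF r]] by blast
  qed
  then have "CL \<union> CR \<subseteq> {v. \<exists>w. Ed v w \<or> Ed w v}" by (auto simp: CL_def)
  ultimately show ?thesis by blast
qed

text \<open>Weak duality. The pairs of owner and owned vertex form a matching, and each contains a
  vertex of \<open>C\<close>; no vertex is chosen twice because left ends never occur as right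
  ends.\<close>

lemma auction_le_cover:
  assumes inv: "auction n Ed p q ow mt" and C: "edge_cover Ed C"
    and bip: "\<And>l r l' r'. Ed l r \<Longrightarrow> Ed l' r' \<Longrightarrow> l \<noteq> r'"
  shows "card {r. r < n \<and> 0 < ow r} \<le> card C"
proof (rule card_inj_on_le)
  let ?f = "\<lambda>r. if r \<in> C then r else ow r - 1"
  have i2: "\<And>r. r < n \<Longrightarrow> 0 < ow r \<Longrightarrow> Ed (ow r - 1) r"
    and i4: "\<And>r r'. r < n \<Longrightarrow> r' < n \<Longrightarrow> 0 < ow r \<Longrightarrow> ow r = ow r' \<Longrightarrow> r = r'"
    using inv unfolding auction_def by blast+
  show "finite C" using C by (simp add: edge_cover_def)
  show "?f ` {r. r < n \<and> 0 < ow r} \<subseteq> C" using C i2 by (auto simp: edge_cover_def)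
  show "inj_on ?f {r. r < n \<and> 0 < ow r}"
  proof (rule inj_onI)
    fix r r' assume *: "r \<in> {r. r < n \<and> 0 < ow r}" "r' \<in> {r. r < n \<and> 0 < ow r}" "?f r = ?f r'"
    then have e: "Ed (ow r - 1) r" "Ed (ow r' - 1) r'" using i2 by auto
    show "r = r'"
    proof (cases "r \<in> C \<longleftrightarrow> r' \<in> C")
      case True
      then show ?thesis
        using * i4[of r r'] by (cases "r \<in> C") (auto simp: eq_diff_iff)
    next
      case False
      then show ?thesis using *(3) bip[OF e] bip[OF e(2,1)] by (auto split: if_splits)
    qed
  qed
qed


section \<open>Reconfiguration and small subsets\<close>

primrec digit_set :: "nat \<Rightarrow> nat \<Rightarrow> nat \<Rightarrow> nat set" where
  "digit_set n 0 c = {}"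
| "digit_set n (Suc m) c = insert (c div n ^ m mod n) (digit_set n m c)"

lemma digit_set_subset: "c < n ^ m \<Longrightarrow> digit_set n i c \<subseteq> {..<n} \<or> m = 0"
  by (induction i) (cases m; cases n; auto)+

text \<open>The recursion of \<open>digit_set\<close> adds digits in the order in which the decoding
  loop meets them, from the least significant one on. The induction for surjectivity needs the
  opposite end.\<close>

lemma digit_set_Suc: "digit_set n (Suc m) c = insert (c mod n) (digit_set n m (c div n))"
  by (induction m) (auto simp: div_mult2_eq)

text \<open>Repeating digits lets a code denote fewer than \<open>m\<close> elements. Only the empty
  set is lost when \<open>m > 0\<close>, as some digit is always present.\<close>

lemma digit_set_surj:
  assumes "X \<subseteq> {..<n}" "card X \<le> m" "m = 0 \<or> X \<noteq> {}"
  shows "\<exists>c < n ^ m. digit_set n m c = X"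
  using assms
proof (induction m arbitrary: X)
  case 0
  then show ?case using finite_subset[of X "{..<n}"] by auto
next
  case (Suc m)
  then obtain x where x: "x \<in> X" by auto
  have fin: "finite X" using Suc.prems(1) finite_subset by blast
  \<comment> \<open>If \<open>x\<close> is the only element left but more digits must be filled, it
    is repeated; this keeps \<open>Y\<close> nonempty.\<close>
  define Y where "Y = (if X = {x} \<and> m \<noteq> 0 then X else X - {x})"
  have "Y \<subseteq> {..<n}" using Suc.prems(1) by (auto simp: Y_def)
  moreover have "card Y \<le> m" using Suc.prems(2) x fin by (auto simp: Y_def)
  moreover have "m = 0 \<or> Y \<noteq> {}" using x by (auto simp: Y_def)
  ultimately obtain c where c: "c < n ^ m" "digit_set n m c = Y" using Suc.IH by blast
  have n: "x < n" using x Suc.prems(1) by auto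
  have "n * c + x < n * (c + 1)" using n by simp
  also have "\<dots> \<le> n * n ^ m" using c(1) by (intro mult_le_mono2) simp
  finally have "n * c + x < n ^ Suc m" by simp
  moreover have "digit_set n (Suc m) (n * c + x) = X"
    unfolding digit_set_Suc using n c(2) x by (auto simp: Y_def split: if_splits)
  ultimately show ?case by blast
qed


section \<open>Testing links between codes\<close>

locale vcr =
  fixes n :: nat and E :: "nat set set" and S T :: "nat set" and k :: nat
  assumes inst: "VCR_instance {..<n} E S T" and k_le: "k \<le> card S"
begin

definition mu :: nat where "mu = card S - k"

definition code_set :: "nat \<Rightarrow> nat set" where "code_set = digit_set n mu"

abbreviation cover :: "nat set \<Rightarrow> bool" where "cover \<equiv> vertex_cover {..<n} E"

definition linked :: "nat \<Rightarrow> nat \<Rightarrow> bool" where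
  "linked c d \<longleftrightarrow> (\<exists>A. cover A \<and> card A \<le> card S \<and> code_set c \<union> code_set d \<subseteq> A)"

definition forced :: "nat \<Rightarrow> nat \<Rightarrow> nat \<Rightarrow> nat set" where
  "forced c d e = (let F = code_set c \<union> code_set d \<union> code_set e in
     F \<union> {v. v < n \<and> (\<exists>u<n. {u, v} \<in> E \<and> u \<in> S \<and> u \<in> T \<and> u \<notin> F)})"

definition bip :: "nat set \<Rightarrow> nat \<Rightarrow> nat \<Rightarrow> bool" where
  "bip F l r \<longleftrightarrow> l \<in> S \<and> l \<notin> T \<and> l \<notin> F \<and> r \<in> T \<and> r \<notin> S \<and> r \<notin> F \<and> {l, r} \<in> E"

definition test :: "nat \<Rightarrow> nat \<Rightarrow> nat \<Rightarrow> bool" where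
  "test c d e \<longleftrightarrow> (\<exists>C \<subseteq> {..<n}. edge_cover (bip (forced c d e)) C \<and>
     card (forced c d e) + card C \<le> card S)"

lemma S_sub: "S \<subseteq> {..<n}" and T_sub: "T \<subseteq> {..<n}" and card_T: "card T = card S"
  and cover_S: "cover S" and cover_T: "cover T"
  using inst by (auto simp: VCR_instance_def vertex_cover_def)

lemma edgeE:
  assumes "e \<in> E" obtains u v where "e = {u, v}" "u < n" "v < n" "u \<noteq> v"
proof -
  have "e \<subseteq> {..<n}" "card e = 2"
    using inst assms by (auto simp: VCR_instance_def simple_graph_def)
  then show thesis using that by (auto simp: card_2_iff)
qed

lemma cover_edge: "cover A \<Longrightarrow> {u, v} \<in> E \<Longrightarrow> u \<in> A \<or> v \<in> A"
  by (auto simp: vertex_cover_def dest!: bspec)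

lemma bip_less: "bip F l r \<Longrightarrow> l < n \<and> r < n"
  using S_sub T_sub by (auto simp: bip_def)

lemma code_set_subset: "c < n ^ mu \<Longrightarrow> code_set c \<subseteq> {..<n}"
  unfolding code_set_def using digit_set_subset[of c n mu mu] by auto

lemma forced_subset: "c < n ^ mu \<Longrightarrow> d < n ^ mu \<Longrightarrow> e < n ^ mu \<Longrightarrow> forced c d e \<subseteq> {..<n}"
  using code_set_subset by (fastforce simp: forced_def Let_def)

lemma code_set_surj: "X \<subseteq> {..<n} \<Longrightarrow> card X = mu \<Longrightarrow> \<exists>c < n ^ mu. code_set c = X"
  unfolding code_set_def by (rule digit_set_surj) auto

text \<open>An edge missed by the forced set has no end in \<open>S \<inter> T\<close>, for such an
  end would lie in \<open>F\<close> or force the other end. Since \<open>S\<close> and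
  \<open>T\<close> both cover the edge, it joins \<open>S - T\<close> and \<open>T - S\<close> and
  is left to \<open>C\<close>.\<close>

lemma test_sound:
  assumes "c < n ^ mu" "d < n ^ mu" "e < n ^ mu" "test c d e"
  shows "linked c d"
proof -
  define F where "F = code_set c \<union> code_set d \<union> code_set e"
  let ?F = "forced c d e"
  obtain C where C: "C \<subseteq> {..<n}" "edge_cover (bip ?F) C" "card ?F + card C \<le> card S"
    using assms(4) by (auto simp: test_def)
  have sub: "F \<subseteq> ?F" by (auto simp: forced_def F_def Let_def)
  have nb: "v \<in> ?F" if "{u, v} \<in> E" "u \<in> S" "u \<in> T" "u \<notin> F" for u v
  proof -
    have "u < n" "v < n" using edgeE[OF that(1)] by (auto simp: doubleton_eq_iff)
    then have "v < n \<and> (\<exists>u<n. {u, v} \<in> E \<and> u \<in> S \<and> u \<in> T \<and> u \<notin> F)" using that by blast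
    then show ?thesis by (simp add: forced_def F_def Let_def)
  qed
  have "u \<in> ?F \<union> C \<or> v \<in> ?F \<union> C" if uv: "{u, v} \<in> E" for u v
  proof (rule ccontr)
    assume *: "\<not> ?thesis"
    have vu: "{v, u} \<in> E" using uv by (simp add: insert_commute)
    have "\<not> (u \<in> S \<and> u \<in> T)" "\<not> (v \<in> S \<and> v \<in> T)"
      using nb[OF uv] nb[OF vu] * sub by auto
    then have "bip ?F u v \<or> bip ?F v u"
      using cover_edge[OF cover_S uv] cover_edge[OF cover_T uv] * uv vu by (auto simp: bip_def)
    then show False using C(2) * by (auto simp: edge_cover_def)
  qed
  then have "(?F \<union> C) \<inter> e \<noteq> {}" if "e \<in> E" for e
    using edgeE[OF that] that by (metis Int_iff empty_iff insertCI)
  then have "cover (?F \<union> C)"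
    unfolding vertex_cover_def using C(1) forced_subset[OF assms(1-3)] by blast
  moreover have "card (?F \<union> C) \<le> card S" using C(3) card_Un_le[of ?F C] by linarith
  ultimately show ?thesis
    unfolding linked_def using sub by (intro exI[of _ "?F \<union> C"]) (auto simp: F_def)
qed

text \<open>
  The code \<open>e\<close> guesses the part of \<open>S \<inter> T\<close> inside the cover.  The rest of \<open>S \<inter> T\<close> is outside, hence its
  neighbours are forced, and the edges that remain join \<open>S - T\<close> and \<open>T - S\<close>.
\<close>

lemma test_complete:
  assumes "card (S \<inter> T) < mu" "c < n ^ mu" "d < n ^ mu" "linked c d"
  shows "\<exists>e < n ^ mu. test c d e"
proof -
  obtain A where A: "cover A" "card A \<le> card S" "code_set c \<union> code_set d \<subseteq> A"
    using assms(4) by (auto simp: linked_def)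
  have fin: "finite A" "A \<subseteq> {..<n}"
    using A(1) finite_subset[of A "{..<n}"] by (auto simp: vertex_cover_def)
  have finZ: "finite (S \<inter> T)" using S_sub finite_subset by blast
  have "\<exists>e < n ^ mu. code_set e \<subseteq> A \<and> A \<inter> (S \<inter> T) \<subseteq> code_set c \<union> code_set d \<union> code_set e"
  proof (cases "A \<inter> (S \<inter> T) = {}")
    case True
    \<comment> \<open>Here \<open>mu > 0\<close>, so the empty set has no code. Reusing
      \<open>c\<close> as the guess adds nothing to the union.\<close>
    then show ?thesis using A(3) assms(2) by (intro exI[of _ c]) auto
  next
    case False
    have "card (A \<inter> (S \<inter> T)) \<le> mu"
      using assms(1) card_mono[OF finZ Int_lower2, of A] by linarith
    then obtain e where "e < n ^ mu" "code_set e = A \<inter> (S \<inter> T)"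
      using digit_set_surj[of "A \<inter> (S \<inter> T)" n mu] False fin unfolding code_set_def by blast
    then show ?thesis by (intro exI[of _ e]) auto
  qed
  then obtain e where e: "e < n ^ mu" "code_set e \<subseteq> A"
    "A \<inter> (S \<inter> T) \<subseteq> code_set c \<union> code_set d \<union> code_set e" by blast
  let ?F = "forced c d e"
  have sub: "?F \<subseteq> A"
  proof
    fix v assume "v \<in> ?F"
    then consider "v \<in> code_set c \<union> code_set d \<union> code_set e"
      | u where "{u, v} \<in> E" "u \<in> S \<inter> T" "u \<notin> code_set c \<union> code_set d \<union> code_set e"
      unfolding forced_def Let_def by blast
    then show "v \<in> A"
    proof cases
      case 1
      then show ?thesis using A(3) e(2) by blast
    next
      case 2
      then show ?thesis using cover_edge[OF A(1) 2(1)] e(3) by blast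
    qed
  qed
  have "edge_cover (bip ?F) (A - ?F)"
    unfolding edge_cover_def using fin(1) cover_edge[OF A(1)] by (auto simp: bip_def)
  moreover have "card ?F + card (A - ?F) \<le> card S"
    using sub A(2) fin(1) card_Diff_subset[OF finite_subset[OF sub fin(1)] sub]
      card_mono[OF fin(1) sub] by simp
  ultimately have "test c d e" unfolding test_def using fin(2) by blast
  then show ?thesis using e(1) by blast
qed

text \<open>For sets of size \<open>card S\<close> the symmetric difference has
  \<open>2 * (card S - card (A \<inter> B))\<close> elements.\<close>

lemma TJ_iff:
  assumes "A \<subseteq> {..<n}" "B \<subseteq> {..<n}" "card A = card S" "card B = card S"
  shows "TJ_adjacent k A B \<longleftrightarrow> mu \<le> card (A \<inter> B)"
proof -
  have fin: "finite A" "finite B" using assms finite_subset by blast+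
  have "card (sym_diff A B) = card (A - B) + card (B - A)"
    using fin by (intro card_Un_disjoint) auto
  moreover have "card (A - B) + card (A \<inter> B) = card S" "card (B - A) + card (A \<inter> B) = card S"
    using card_Int_Diff[OF fin(1), of B] card_Int_Diff[OF fin(2), of A] assms
    by (simp_all add: Int_commute)
  ultimately show ?thesis using assms k_le by (simp add: TJ_adjacent_def mu_def) linarith
qed

section \<open>Reachability of covers in terms of codes\<close>

abbreviation reachable :: "nat set \<Rightarrow> bool" where
  "reachable A \<equiv> VCR_yes {..<n} E S A k"

lemma reachable_refl: "reachable S"
  unfolding VCR_yes_def using cover_S by (intro exI[of _ 0] exI[of _ "\<lambda>_. S"]) auto

lemma reachable_step:
  assumes "reachable A" "cover B" "TJ_adjacent k A B"
  shows "reachable B"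
proof -
  obtain l :: nat and \<sigma> where *: "\<sigma> 0 = S" "\<sigma> l = A" "\<forall>i\<le>l. cover (\<sigma> i)"
    "\<forall>i\<in>{1..l}. TJ_adjacent k (\<sigma> (i - 1)) (\<sigma> i)"
    using assms(1) unfolding VCR_yes_def by (elim exE conjE) (rule that)
  have "\<forall>i\<in>{1..Suc l}. TJ_adjacent k ((\<sigma>(Suc l := B)) (i - 1)) ((\<sigma>(Suc l := B)) i)"
  proof
    fix i assume "i \<in> {1..Suc l}"
    then show "TJ_adjacent k ((\<sigma>(Suc l := B)) (i - 1)) ((\<sigma>(Suc l := B)) i)"
      using *(2,4) assms(3) by (cases "i = Suc l") auto
  qed
  moreover have "\<forall>i\<le>Suc l. cover ((\<sigma>(Suc l := B)) i)" using * assms(2) by auto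
  ultimately show ?thesis
    unfolding VCR_yes_def using *(1) by (intro exI[of _ "Suc l"] exI[of _ "\<sigma>(Suc l := B)"]) simp
qed

text \<open>The soundness invariant of the search for a marked code. It may hold vacuously, when no
  cover of the right size contains the set.\<close>

definition good :: "nat \<Rightarrow> bool" where
  "good c \<longleftrightarrow> (\<forall>A. cover A \<longrightarrow> card A = card S \<longrightarrow> code_set c \<subseteq> A \<longrightarrow> reachable A)"

lemma good_init:
  assumes "c < n ^ mu" "card (code_set c) = mu" "code_set c \<subseteq> S"
  shows "good c"
  unfolding good_def
proof (intro allI impI)
  fix A assume A: "cover A" "card A = card S" "code_set c \<subseteq> A"
  have "finite S" using S_sub finite_subset by blast
  then have "mu \<le> card (S \<inter> A)"
    using assms(2,3) A(3) card_mono[of "S \<inter> A" "code_set c"] by simp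
  then have "TJ_adjacent k S A" using TJ_iff[OF S_sub, of A] A by (auto simp: vertex_cover_def)
  then show "reachable A" using reachable_step[OF reachable_refl] A by blast
qed

text \<open>Pad the cover witnessing the link to exactly \<open>card S\<close> vertices. It contains
  the first set, hence is reachable, and it shares the second set with \<open>A\<close>, hence is
  one jump away from \<open>A\<close>.\<close>

lemma good_step:
  assumes "good c" "d < n ^ mu" "card (code_set d) = mu" "linked c d"
  shows "good d"
  unfolding good_def
proof (intro allI impI)
  fix A assume A: "cover A" "card A = card S" "code_set d \<subseteq> A"
  obtain B0 where B0: "cover B0" "card B0 \<le> card S" "code_set c \<union> code_set d \<subseteq> B0"
    using assms(4) by (auto simp: linked_def)
  have "card S \<le> card {..<n}" using S_sub by (intro card_mono) auto
  then obtain B where B: "B0 \<subseteq> B" "B \<subseteq> {..<n}" "card B = card S"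
    using exists_subset_between[of B0 "card S" "{..<n}"] B0 by (auto simp: vertex_cover_def)
  have cB: "cover B" using B0(1) B(1,2) unfolding vertex_cover_def by blast
  then have "reachable B" using assms(1) B0(3) B unfolding good_def by blast
  moreover have "mu \<le> card (B \<inter> A)"
    using assms(3) A(3) B0(3) B(1) card_mono[of "B \<inter> A" "code_set d"] finite_subset[OF B(2)] by auto
  then have "TJ_adjacent k B A" using TJ_iff[OF B(2), of A] A B by (auto simp: vertex_cover_def)
  ultimately show "reachable A" using reachable_step A(1) by blast
qed

text \<open>Separates the search from its implementation: any set of codes that contains the initial
  ones, is closed under successful tests and stays inside the good codes decides the
  instance.\<close>

lemma reachable_iff_marked:
  assumes init: "\<And>c. \<lbrakk>c < n ^ mu; card (code_set c) = mu; code_set c \<subseteq> S\<rbrakk> \<Longrightarrow> c \<in> M"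
    and closed: "\<And>c d e. \<lbrakk>c \<in> M; c < n ^ mu; d < n ^ mu; e < n ^ mu; card (code_set d) = mu; test c d e\<rbrakk>
      \<Longrightarrow> d \<in> M"
    and good: "\<And>c. c \<in> M \<Longrightarrow> good c"
  shows "reachable T \<longleftrightarrow> (\<exists>c < n ^ mu. c \<in> M \<and> card (code_set c) = mu \<and> code_set c \<subseteq> T)"
proof
  assume "\<exists>c < n ^ mu. c \<in> M \<and> card (code_set c) = mu \<and> code_set c \<subseteq> T"
  then show "reachable T" using good cover_T card_T unfolding good_def by metis
next
  assume "reachable T"
  then obtain l :: nat and \<sigma> where *: "\<sigma> 0 = S" "\<sigma> l = T" "\<And>i. i \<le> l \<Longrightarrow> cover (\<sigma> i)"
    "\<And>i. i\<in>{1..l} \<Longrightarrow> TJ_adjacent k (\<sigma> (i - 1)) (\<sigma> i)"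
    unfolding VCR_yes_def by blast
  show "\<exists>c < n ^ mu. c \<in> M \<and> card (code_set c) = mu \<and> code_set c \<subseteq> T"
  \<comment> \<open>The test is complete only for small \<open>S \<inter> T\<close>. If
    \<open>S \<inter> T\<close> is large, one of its \<open>mu\<close>-subsets is initial and
    already lies in \<open>T\<close>.\<close>
  proof (cases "mu \<le> card (S \<inter> T)")
    case True
    then obtain X where X: "X \<subseteq> S \<inter> T" "card X = mu" using obtain_subset_with_card_n by metis
    then have "X \<subseteq> {..<n}" using S_sub by blast
    then obtain c where "c < n ^ mu" "code_set c = X" using code_set_surj X(2) by blast
    then show ?thesis using init[of c] X by (intro exI[of _ c]) auto
  next
    case False
    have card: "card (\<sigma> i) = card S" if "i \<le> l" for i
      using that
    proof (induction i)
      case (Suc i)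
      then show ?case using *(4)[of "Suc i"] by (simp add: TJ_adjacent_def)
    qed (simp add: *)
    have sub: "\<sigma> i \<subseteq> {..<n}" if "i \<le> l" for i
      using *(3)[OF that] by (simp add: vertex_cover_def)
    \<comment> \<open>The claim is about all codes inside \<open>\<sigma> i\<close>. To pass to
      \<open>\<sigma> (Suc i)\<close>, start from a \<open>mu\<close>-set common to both covers; the
      cover \<open>\<sigma> (Suc i)\<close> itself links it to every code inside it.\<close>
    have "\<forall>c < n ^ mu. card (code_set c) = mu \<longrightarrow> code_set c \<subseteq> \<sigma> i \<longrightarrow> c \<in> M" if "i \<le> l" for i
      using that
    proof (induction i)
      case 0
      then show ?case using init * by simp
    next
      case (Suc i)
      have "mu \<le> card (\<sigma> i \<inter> \<sigma> (Suc i))"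
        using *(4)[of "Suc i"] TJ_iff[OF sub sub card card, of i "Suc i"] Suc.prems by simp
      then obtain Y where Y: "Y \<subseteq> \<sigma> i \<inter> \<sigma> (Suc i)" "card Y = mu"
        using obtain_subset_with_card_n by metis
      have "Y \<subseteq> {..<n}" using Y(1) sub[of i] Suc.prems by auto
      then obtain c where c: "c < n ^ mu" "code_set c = Y" using code_set_surj Y(2) by blast
      have cM: "c \<in> M" using Suc c Y by auto
      show ?case
      proof (intro allI impI)
        fix d assume d: "d < n ^ mu" "card (code_set d) = mu" "code_set d \<subseteq> \<sigma> (Suc i)"
        have "linked c d"
          unfolding linked_def using *(3)[of "Suc i"] card[of "Suc i"] Suc.prems d(3) c(2) Y(1)
          by (intro exI[of _ "\<sigma> (Suc i)"]) auto
        then obtain e where "e < n ^ mu" "test c d e"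
          using test_complete False c(1) d(1) by (meson not_le)
        then show "d \<in> M" using closed cM c(1) d by blast
      qed
    qed
    from this[of l] have M: "\<And>c. c < n ^ mu \<Longrightarrow> card (code_set c) = mu \<Longrightarrow> code_set c \<subseteq> T \<Longrightarrow> c \<in> M"
      using *(2) by auto
    have "mu \<le> card T" using card_T by (simp add: mu_def)
    then obtain X where X: "X \<subseteq> T" "card X = mu" using obtain_subset_with_card_n by metis
    then have "X \<subseteq> {..<n}" using T_sub by blast
    then obtain c where "c < n ^ mu" "code_set c = X" using code_set_surj X(2) by blast
    then show ?thesis using M[of c] X by (intro exI[of _ c]) auto
  qed
qed

end

section \<open>The program\<close>

declare den.simps(5) [simp del]

abbreviation Eq :: "aexp \<Rightarrow> aexp \<Rightarrow> bexp" where
  "Eq a b \<equiv> Conj (Neg (Less a b)) (Neg (Less b a))"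

abbreviation Pos :: "aexp \<Rightarrow> bexp" where "Pos a \<equiv> Less (Num 0) a"

abbreviation Zero :: "aexp \<Rightarrow> bexp" where "Zero a \<equiv> Less a (Num 1)"

text \<open>The offsets here and below follow the encoding: two header cells, the two vectors of
  length \<open>n\<close>, then the matrix.\<close>

definition inS :: "aexp \<Rightarrow> aexp" where
  "inS a = Read ''in'' (Plus (Num 2) a)"

definition inT :: "aexp \<Rightarrow> aexp" where
  "inT a = Read ''in'' (Plus (Plus (Num 2) (Var ''in'')) a)"

text \<open>The array \<open>mn\<close> holds the multiples of \<open>n\<close>, for want of a multiplication.\<close>

definition adj :: "aexp \<Rightarrow> aexp \<Rightarrow> aexp" where
  "adj a b = Read ''in''
     (Plus (Plus (Plus (Num 2) (Var ''in'')) (Var ''in'')) (Plus (Read ''mn'' a) b))"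

text \<open>
  A vertex set is stored as a 0/1 array: \<open>f\<close> holds the union of the decoded code sets and \<open>g\<close> the
  vertices forced into the cover.  \<open>p\<close>, \<open>q\<close>, \<open>ow\<close>, \<open>mt\<close> are the arrays of the auction.  For a code,
  \<open>vd\<close> says that its set has exactly \<open>\<mu>\<close> elements, \<open>mark\<close> that it has been reached and \<open>tg\<close> that
  its set is contained in \<open>T\<close>.  Cell 0 of \<open>in\<close> is \<open>n\<close>, which therefore serves as a loop bound.
\<close>

definition DECODE_BODY :: lcom where
  "DECODE_BODY = LAssign ''f'' (Read ''rm'' (Var ''cc'')) (Num 1) ;;
       LSet ''cc'' (Read ''dv'' (Var ''cc''))"

definition DECODE :: "string \<Rightarrow> lcom" where
  "DECODE x = LSet ''cc'' (Var x) ;; LFor ''i'' ''mu'' DECODE_BODY"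

definition CLEAR :: lcom where
  "CLEAR = LFor ''v'' ''in'' (LAssign ''f'' (Var ''v'') (Num 0))"

definition INSPECT_BODY :: lcom where
  "INSPECT_BODY = LCond (Pos (Read ''f'' (Var ''v'')))
       (LSet ''cnt'' (Plus (Var ''cnt'') (Num 1)) ;;
        LCond (Zero (inS (Var ''v''))) (LSet ''sS'' (Num 0)) LSkip ;;
        LCond (Zero (inT (Var ''v''))) (LSet ''sT'' (Num 0)) LSkip)
       LSkip"

definition INSPECT :: "string \<Rightarrow> lcom" where
  "INSPECT x = CLEAR ;; DECODE x ;;
     LSet ''cnt'' (Num 0) ;; LSet ''sS'' (Num 1) ;; LSet ''sT'' (Num 1) ;;
     LFor ''v'' ''in'' INSPECT_BODY"

definition FORCE_INNER :: lcom where
  "FORCE_INNER = LCond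
       (Conj (Pos (adj (Var ''u'') (Var ''v'')))
         (Conj (Pos (inS (Var ''u'')))
         (Conj (Pos (inT (Var ''u''))) (Zero (Read ''f'' (Var ''u''))))))
       (LAssign ''g'' (Var ''v'') (Num 1)) LSkip"

definition FORCE_BODY :: lcom where
  "FORCE_BODY = LAssign ''g'' (Var ''v'') (Read ''f'' (Var ''v'')) ;; LFor ''u'' ''in'' FORCE_INNER"

definition FORCE :: lcom where
  "FORCE = LFor ''v'' ''in'' FORCE_BODY"

text \<open>The guard on \<open>mt\<close> lets \<open>l\<close> take only the first vertex whose
  price equals its offer; the rest of the scan is then idle.\<close>

definition BIDS_BODY :: lcom where
  "BIDS_BODY = LCond
     (Conj (Zero (Read ''mt'' (Var ''l'')))
       (Conj (Zero (inS (Var ''r''))) (Conj (Pos (inT (Var ''r''))) (Conj (Zero (Read ''g'' (Var ''r'')))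
       (Conj (Pos (adj (Var ''l'') (Var ''r'')))
             (Eq (Read ''p'' (Var ''r'')) (Read ''q'' (Var ''l''))))))))
     (LCond (Pos (Read ''ow'' (Var ''r'')))
        (LAssign ''mt'' (Minus (Read ''ow'' (Var ''r'')) (Num 1)) (Num 0)) LSkip ;;
      LAssign ''ow'' (Var ''r'') (Plus (Var ''l'') (Num 1)) ;;
      LAssign ''p'' (Var ''r'') (Plus (Read ''p'' (Var ''r'')) (Num 1)) ;;
      LAssign ''mt'' (Var ''l'') (Num 1))
     LSkip"

definition BIDS :: lcom where
  "BIDS = LFor ''r'' ''in'' BIDS_BODY"

definition BID_RAISE :: lcom where
  "BID_RAISE = BIDS ;; LCond (Zero (Read ''mt'' (Var ''l'')))
        (LAssign ''q'' (Var ''l'') (Plus (Read ''q'' (Var ''l'')) (Num 1))) LSkip"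

definition PASS_BODY :: lcom where
  "PASS_BODY = LCond
     (Conj (Pos (inS (Var ''l''))) (Conj (Zero (inT (Var ''l''))) (Conj (Zero (Read ''g'' (Var ''l'')))
       (Conj (Zero (Read ''mt'' (Var ''l'')))
             (Less (Read ''q'' (Var ''l'')) (Plus (Var ''in'') (Num 1)))))))
     BID_RAISE LSkip"

definition PASS :: lcom where
  "PASS = LFor ''l'' ''in'' PASS_BODY"

definition CLEAR_AUCTION :: lcom where
  "CLEAR_AUCTION = LFor ''v'' ''in'' (LAssign ''p'' (Var ''v'') (Num 0) ;;
       LAssign ''q'' (Var ''v'') (Num 0) ;; LAssign ''ow'' (Var ''v'') (Num 0) ;;
       LAssign ''mt'' (Var ''v'') (Num 0))"

text \<open>A fixed number of passes replaces a termination check: \<open>K\<close> exceeds the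
  largest possible potential, and passes after stability change nothing.\<close>

definition AUCTION :: lcom where
  "AUCTION = CLEAR_AUCTION ;; LFor ''a'' ''K'' PASS"

text \<open>No cover is constructed. By duality the number of owned vertices in a settled auction is
  already the minimum size of a cover of the bipartite part.\<close>

definition COUNT_BODY :: lcom where
  "COUNT_BODY = LSet ''cnt'' (Plus (Var ''cnt'') (Read ''g'' (Var ''v''))) ;;
       LCond (Pos (Read ''ow'' (Var ''v''))) (LSet ''cnt'' (Plus (Var ''cnt'') (Num 1))) LSkip"

definition COUNT :: lcom where
  "COUNT = LSet ''cnt'' (Num 0) ;;
     LFor ''v'' ''in'' COUNT_BODY ;;
     LCond (Less (Var ''s'') (Var ''cnt'')) (LSet ''res'' (Num 0)) (LSet ''res'' (Num 1))"

definition TEST :: lcom where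
  "TEST = CLEAR ;; DECODE ''c'' ;; DECODE ''d'' ;; DECODE ''e'' ;; FORCE ;; AUCTION ;; COUNT"

definition LINK_BODY :: lcom where
  "LINK_BODY = TEST ;; LCond (Pos (Var ''res'')) (LSet ''ex'' (Num 1)) LSkip"

definition LINK :: lcom where
  "LINK = LSet ''ex'' (Num 0) ;; LFor ''e'' ''N'' LINK_BODY"

definition CLOSE_ROW_BODY :: lcom where
  "CLOSE_ROW_BODY = LINK ;;
     LCond (Conj (Pos (Read ''mark'' (Var ''c''))) (Conj (Pos (Read ''vd'' (Var ''d''))) (Pos (Var ''ex''))))
       (LAssign ''mark'' (Var ''d'') (Num 1)) LSkip"

definition CLOSE_ROW :: lcom where
  "CLOSE_ROW = LFor ''d'' ''N'' CLOSE_ROW_BODY"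

definition CLOSE_PASS :: lcom where
  "CLOSE_PASS = LFor ''c'' ''N'' CLOSE_ROW"

text \<open>\<open>N\<close> passes suffice, since every pass before closure marks a new one of the
  \<open>N\<close> codes.\<close>

definition CLOSE :: lcom where
  "CLOSE = LFor ''it'' ''N'' CLOSE_PASS"

definition INIT_BODY :: lcom where
  "INIT_BODY = INSPECT ''c'' ;;
     LAssign ''vd'' (Var ''c'') (Num 0) ;; LAssign ''mark'' (Var ''c'') (Num 0) ;;
     LAssign ''tg'' (Var ''c'') (Num 0) ;;
     LCond (Eq (Var ''cnt'') (Var ''mu''))
       (LAssign ''vd'' (Var ''c'') (Num 1) ;; LAssign ''mark'' (Var ''c'') (Var ''sS'') ;;
        LAssign ''tg'' (Var ''c'') (Var ''sT'')) LSkip"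

definition INIT :: lcom where
  "INIT = LFor ''c'' ''N'' INIT_BODY"

definition FINAL_BODY :: lcom where
  "FINAL_BODY = LCond (Conj (Pos (Read ''mark'' (Var ''c''))) (Pos (Read ''tg'' (Var ''c''))))
       (LSet ''out'' (Num 1)) LSkip"

definition FINAL :: lcom where
  "FINAL = LSet ''out'' (Num 0) ;; LFor ''c'' ''N'' FINAL_BODY"

definition MAIN :: lcom where
  "MAIN = INIT ;; CLOSE ;; FINAL"

definition MN_BODY :: lcom where
  "MN_BODY = LAssign ''mn'' (Var ''v'') (Var ''a1'') ;; LSet ''a1'' (Plus (Var ''a1'') (Var ''in''))"

text \<open>Division by counting with carry: \<open>a1\<close> and \<open>b1\<close> are the
  quotient and remainder of the current code by \<open>n\<close>.\<close>

definition DIVMOD_BODY :: lcom where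
  "DIVMOD_BODY = LAssign ''dv'' (Var ''c'') (Var ''a1'') ;; LAssign ''rm'' (Var ''c'') (Var ''b1'') ;;
       LSet ''b1'' (Plus (Var ''b1'') (Num 1)) ;;
       LCond (Eq (Var ''b1'') (Var ''in''))
         (LSet ''b1'' (Num 0) ;; LSet ''a1'' (Plus (Var ''a1'') (Num 1))) LSkip"

definition TABLES :: lcom where
  "TABLES = LSet ''a1'' (Num 0) ;;
     LFor ''v'' ''in'' MN_BODY ;;
     LSet ''a1'' (Num 0) ;; LSet ''b1'' (Num 0) ;;
     LFor ''c'' ''N'' DIVMOD_BODY"

definition SIZES_BODY :: lcom where
  "SIZES_BODY = LSet ''s'' (Plus (Var ''s'') (inS (Var ''v'')))"

definition SIZES :: lcom where
  "SIZES = LSet ''s'' (Num 0) ;;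
     LFor ''v'' ''in'' SIZES_BODY ;;
     LSet ''mu'' (Minus (Var ''s'') (Read ''in'' (Num 1)))"

definition ADD_N :: lcom where
  "ADD_N = LSet ''cc'' (Plus (Var ''cc'') (Var ''N''))"

definition TIMES_n :: lcom where
  "TIMES_n = LSet ''cc'' (Num 0) ;; LFor ''v'' ''in'' ADD_N ;; LSet ''N'' (Var ''cc'')"

text \<open>Executed \<open>n\<close> times from 1, this yields \<open>2 * n * (n + 1) + 1\<close>,
  one more than the sum of \<open>2 * n\<close> prices and offers that are each at most
  \<open>n + 1\<close>.\<close>

definition K_BODY :: lcom where
  "K_BODY = LSet ''K'' (Plus (Var ''K'') (Plus (Plus (Var ''in'') (Var ''in'')) (Num 2)))"

definition POWERS :: lcom where
  "POWERS = LSet ''N'' (Num 1) ;;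
     LFor ''i'' ''mu'' TIMES_n ;;
     LSet ''K'' (Num 1) ;;
     LFor ''v'' ''in'' K_BODY"

lemma writes_prog [simp]:
  "writes (DECODE x) = {''cc'', ''i'', ''f''}"
  "writes CLEAR = {''v'', ''f''}"
  "writes (INSPECT x) = {''v'', ''f'', ''cc'', ''i'', ''cnt'', ''sS'', ''sT''}"
  "writes FORCE = {''v'', ''u'', ''g''}"
  "writes BIDS = {''r'', ''mt'', ''ow'', ''p''}"
  "writes PASS = {''l'', ''r'', ''mt'', ''ow'', ''p'', ''q''}"
  "writes AUCTION = {''a'', ''v'', ''l'', ''r'', ''mt'', ''ow'', ''p'', ''q''}"
  "writes COUNT = {''v'', ''cnt'', ''res''}"
  by (auto simp: DECODE_def DECODE_BODY_def CLEAR_def INSPECT_def INSPECT_BODY_def FORCE_def FORCE_BODY_def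
      FORCE_INNER_def BIDS_def BIDS_BODY_def PASS_def PASS_BODY_def BID_RAISE_def AUCTION_def
      CLEAR_AUCTION_def COUNT_def COUNT_BODY_def)

lemma writes_TEST [simp]:
  "writes TEST = {''cc'', ''i'', ''f'', ''v'', ''u'', ''g'', ''a'', ''l'', ''r'', ''mt'', ''ow'', ''p'',
     ''q'', ''cnt'', ''res''}"
  by (auto simp: TEST_def)

lemma writes_LINK [simp]:
  "writes LINK = {''ex'', ''e'', ''cc'', ''i'', ''f'', ''v'', ''u'', ''g'', ''a'', ''l'', ''r'', ''mt'', ''ow'',
     ''p'', ''q'', ''cnt'', ''res''}"
  by (auto simp: LINK_def LINK_BODY_def)

lemma writes_CLOSE_ROW [simp]: "writes CLOSE_ROW = insert ''d'' (insert ''mark'' (writes LINK))"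
  by (auto simp: CLOSE_ROW_def CLOSE_ROW_BODY_def)

lemma writes_CLOSE_PASS [simp]: "writes CLOSE_PASS = insert ''c'' (writes CLOSE_ROW)"
  by (simp add: CLOSE_PASS_def)

lemma sum_upd_Suc:
  fixes f :: "nat \<Rightarrow> nat"
  assumes "r < n"
  shows "(\<Sum>v<n. (f(r := Suc (f r))) v) = Suc (\<Sum>v<n. f v)"
proof -
  have "(\<Sum>v<n. (f(r := Suc (f r))) v) = Suc (f r) + (\<Sum>v\<in>{..<n} - {r}. (f(r := Suc (f r))) v)"
    using assms by (subst sum.remove[of _ r]) auto
  also have "(\<Sum>v\<in>{..<n} - {r}. (f(r := Suc (f r))) v) = (\<Sum>v\<in>{..<n} - {r}. f v)"
    by (rule sum.cong) auto
  finally show ?thesis using assms by (subst (2) sum.remove[of _ r]) auto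
qed

lemma card_less_Suc: "card {v. v < Suc i \<and> P v} = card {v. v < i \<and> P v} + of_bool (P i)"
proof -
  have "{v. v < Suc i \<and> P v} = (if P i then insert i {v. v < i \<and> P v} else {v. v < i \<and> P v})"
    by (auto simp: less_Suc_eq)
  then show ?thesis by simp
qed

section \<open>Correctness of decoding, inspection and forcing\<close>

context vcr
begin

definition inp :: "nat \<Rightarrow> nat" where
  "inp = input_state (VCR_encode n E S T k) ''in''"

lemma inp_head [simp]: "inp 0 = n" "inp (Suc 0) = k"
  by (simp_all add: inp_def input_state_def VCR_encode_def)

lemma inp_S: "v < n \<Longrightarrow> inp (Suc (Suc v)) = of_bool (v \<in> S)"
  by (simp add: inp_def input_state_def VCR_encode_def nth_append)

lemma inp_T: "v < n \<Longrightarrow> inp (Suc (Suc (n + v))) = of_bool (v \<in> T)"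
  by (simp add: inp_def input_state_def VCR_encode_def nth_append)

lemma inp_adj:
  assumes "u < n" "v < n"
  shows "inp (Suc (Suc (n + n + (n * u + v)))) = of_bool ({u, v} \<in> E)"
proof -
  have "n * u + v < n * Suc u" using assms by simp
  also have "\<dots> \<le> n * n" using assms by (intro mult_le_mono2) simp
  finally show ?thesis
    using assms by (simp add: inp_def input_state_def VCR_encode_def nth_append)
qed

definition params :: "string set" where [simp]:
  "params = {''in'', ''s'', ''mu'', ''N'', ''K'', ''mn'', ''dv'', ''rm''}"

text \<open>What the preprocessing establishes and \<open>MAIN\<close> never overwrites: the input,
  the loop bounds and the arithmetic tables. \<open>den_LFor_env\<close> hands it to each loop step,
  so that loop invariants can omit it.\<close>

definition env :: "state \<Rightarrow> bool" where
  "env s \<longleftrightarrow> s ''in'' = inp \<and> s ''s'' 0 = card S \<and> s ''mu'' 0 = mu \<and> s ''N'' 0 = n ^ mu \<and>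
     s ''K'' 0 = 2 * n * (n + 1) + 1 \<and> (\<forall>u<n. s ''mn'' u = n * u) \<and>
     (\<forall>c<n ^ mu. s ''dv'' c = c div n \<and> s ''rm'' c = c mod n)"

lemma env_cong: "env s \<Longrightarrow> (\<And>y. y \<in> params \<Longrightarrow> s' y = s y) \<Longrightarrow> env s'"
  by (simp add: env_def)

lemma env_upd [simp]: "x \<notin> params \<Longrightarrow> env (s(x := g)) = env s"
  by (auto simp: env_def)

lemma env_den: "env s \<Longrightarrow> writes c \<inter> params = {} \<Longrightarrow> env (den c s)"
  by (erule env_cong) (auto intro!: den_frame)

lemma env_simps: "env s \<Longrightarrow> s ''in'' = inp" "env s \<Longrightarrow> s ''s'' 0 = card S"
  "env s \<Longrightarrow> s ''mu'' 0 = mu" "env s \<Longrightarrow> s ''N'' 0 = n ^ mu"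
  "env s \<Longrightarrow> s ''K'' 0 = 2 * n * (n + 1) + 1" "env s \<Longrightarrow> u < n \<Longrightarrow> s ''mn'' u = n * u"
  "env s \<Longrightarrow> c < n ^ mu \<Longrightarrow> s ''dv'' c = c div n" "env s \<Longrightarrow> c < n ^ mu \<Longrightarrow> s ''rm'' c = c mod n"
  by (auto simp: env_def)

lemma aval_inS: "env s \<Longrightarrow> aval a s < n \<Longrightarrow> aval (inS a) s = of_bool (aval a s \<in> S)"
  by (simp add: inS_def env_simps inp_S)

lemma aval_inT: "env s \<Longrightarrow> aval a s < n \<Longrightarrow> aval (inT a) s = of_bool (aval a s \<in> T)"
  by (simp add: inT_def env_simps inp_T)

lemma aval_adj: "env s \<Longrightarrow> aval a s < n \<Longrightarrow> aval b s < n \<Longrightarrow>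
    aval (adj a b) s = of_bool ({aval a s, aval b s} \<in> E)"
  by (simp add: adj_def env_simps inp_adj)

declare env_simps(1-5) [simp]

lemma den_LFor_env:
  assumes "env s" "insert x (writes c) \<inter> params = {}" "x \<notin> writes c" "b \<in> params"
    and init: "P 0 (s(x := (s x)(0 := 0)))"
    and step: "\<And>i s'. \<lbrakk>i < s b 0; env s'; P i s'; s' x 0 = i;
          \<And>y. y \<noteq> x \<Longrightarrow> y \<notin> writes c \<Longrightarrow> s' y = s y\<rbrakk>
        \<Longrightarrow> P (Suc i) ((den c s')(x := (den c s' x)(0 := Suc i)))"
  shows "P (s b 0) (den (LFor x b c) s)"
proof (rule den_LFor_induct[where P = P])
  fix i s'
  assume *: "i < s b 0" "P i s'" "s' x 0 = i" "\<And>y. y \<noteq> x \<Longrightarrow> y \<notin> writes c \<Longrightarrow> s' y = s y"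
  have "env s'" by (rule env_cong[OF assms(1)]) (use *(4) assms(2) in blast)
  then show "P (Suc i) ((den c s')(x := (den c s' x)(0 := Suc i)))" using step * by blast
qed (use assms in auto)

text \<open>\<open>f\<close> is only added to, so successive decodings accumulate a union.\<close>

lemma den_DECODE:
  assumes "env s" "s x 0 < n ^ mu" "x \<notin> {''cc'', ''i'', ''f''}"
  shows "den (DECODE x) s ''f'' = (\<lambda>v. if v \<in> code_set (s x 0) then 1 else s ''f'' v)"
proof -
  define s0 where "s0 = s(''cc'' := (s ''cc'')(0 := s x 0))"
  define P where "P = (\<lambda>i t. t ''f'' = (\<lambda>v. if v \<in> digit_set n i (s x 0) then 1 else s ''f'' v) \<and>
    t ''cc'' 0 = s x 0 div n ^ i)"
  have env: "env s0" using assms(1) by (simp add: s0_def)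
  have "P (s0 ''mu'' 0) (den (LFor ''i'' ''mu'' DECODE_BODY) s0)"
  proof (rule den_LFor_env[OF env])
    show "P 0 (s0(''i'' := (s0 ''i'')(0 := 0)))" by (simp add: P_def s0_def)
  next
    fix i t assume t: "env t" "P i t" "t ''i'' 0 = i"
    \<comment> \<open>The successive quotients stay within the range of the tables.\<close>
    have "s x 0 div n ^ i < n ^ mu" using assms(2) by (meson div_le_dividend le_less_trans)
    then have "t ''rm'' (s x 0 div n ^ i) = s x 0 div n ^ i mod n"
      "t ''dv'' (s x 0 div n ^ i) = s x 0 div n ^ Suc i"
      using t(1) by (simp_all add: env_simps power_Suc2 div_mult2_eq del: power_Suc)
    then show "P (Suc i) ((den DECODE_BODY t)(''i'' := (den DECODE_BODY t ''i'')(0 := Suc i)))"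
      using t(2,3) by (auto simp: P_def DECODE_BODY_def)
  qed (simp_all add: DECODE_BODY_def)
  then show ?thesis using env by (simp add: P_def DECODE_def DECODE_BODY_def s0_def code_set_def)
qed

lemma den_CLEAR:
  assumes "env s"
  shows "den CLEAR s ''f'' v = (if v < n then 0 else s ''f'' v)"
proof -
  define P where "P = (\<lambda>i t. \<forall>v. t ''f'' v = (if v < (i::nat) then (0::nat) else s ''f'' v))"
  have "P (s ''in'' 0) (den CLEAR s)"
    unfolding CLEAR_def
    by (rule den_LFor_env[OF assms]) (auto simp: P_def less_Suc_eq)
  then show ?thesis using assms by (simp add: P_def)
qed

lemma den_INSPECT:
  assumes env: "env s" and x: "s x 0 < n ^ mu" "x \<notin> {''v'', ''cc'', ''i'', ''f''}"
  defines "t \<equiv> den (INSPECT x) s" and "X \<equiv> code_set (s x 0)"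
  shows "t ''cnt'' 0 = card X" "t ''sS'' 0 = of_bool (X \<subseteq> S)" "t ''sT'' 0 = of_bool (X \<subseteq> T)"
proof -
  define s1 where "s1 = den CLEAR s"
  define s2 where "s2 = den (DECODE x) s1"
  define s3 where "s3 = den (LSet ''cnt'' (Num 0) ;; LSet ''sS'' (Num 1) ;; LSet ''sT'' (Num 1)) s2"
  have e1: "env s1" using env by (simp add: s1_def env_den)
  have e2: "env s2" using e1 by (simp add: s2_def env_den)
  have e3: "env s3" using e2 by (simp add: s3_def)
  have "s1 x = s x" using x(2) by (simp add: s1_def den_frame)
  then have f: "s3 ''f'' v = of_bool (v \<in> X)" if "v < n" for v
    using den_DECODE[OF e1, of x] x den_CLEAR[OF env, of v] that by (simp add: s3_def s2_def s1_def X_def)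
  define P :: "nat \<Rightarrow> state \<Rightarrow> bool" where
    "P = (\<lambda>i t. t ''cnt'' 0 = card {v. v < i \<and> v \<in> X} \<and>
      t ''sS'' 0 = of_bool (\<forall>v<i. v \<in> X \<longrightarrow> v \<in> S) \<and> t ''sT'' 0 = of_bool (\<forall>v<i. v \<in> X \<longrightarrow> v \<in> T))"
  have "P (s3 ''in'' 0) (den (LFor ''v'' ''in'' INSPECT_BODY) s3)"
  proof (rule den_LFor_env[OF e3])
    show "P 0 (s3(''v'' := (s3 ''v'')(0 := 0)))" by (simp add: P_def s3_def)
  next
    fix i t assume t: "i < s3 ''in'' 0" "env t" "P i t" "t ''v'' 0 = i"
      "\<And>y. y \<noteq> ''v'' \<Longrightarrow> y \<notin> writes INSPECT_BODY \<Longrightarrow> t y = s3 y"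
    have i: "i < n" using t(1) e3 by simp
    have "t ''f'' = s3 ''f''" using t(5)[of "''f''"] by (simp add: INSPECT_BODY_def)
    then have "t ''f'' i = of_bool (i \<in> X)" using f[OF i] by simp
    then show "P (Suc i) ((den INSPECT_BODY t)(''v'' := (den INSPECT_BODY t ''v'')(0 := Suc i)))"
      using t(2-4) i
      by (simp add: P_def INSPECT_BODY_def aval_inS aval_inT card_less_Suc All_less_Suc)
  qed (simp_all add: INSPECT_BODY_def)
  moreover have "t = den (LFor ''v'' ''in'' INSPECT_BODY) s3"
    by (simp add: t_def INSPECT_def s3_def s2_def s1_def INSPECT_BODY_def)
  moreover have "X \<subseteq> {..<n}" using code_set_subset x(1) X_def by blast
  then have "{v. v < n \<and> v \<in> X} = X" "(\<forall>v<n. v \<in> X \<longrightarrow> v \<in> S) = (X \<subseteq> S)"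
    "(\<forall>v<n. v \<in> X \<longrightarrow> v \<in> T) = (X \<subseteq> T)" by auto
  ultimately show "t ''cnt'' 0 = card X" "t ''sS'' 0 = of_bool (X \<subseteq> S)" "t ''sT'' 0 = of_bool (X \<subseteq> T)"
    using e3 by (simp_all add: P_def)
qed

lemma den_FORCE:
  assumes env: "env s" and f: "\<And>v. v < n \<Longrightarrow> s ''f'' v = of_bool (v \<in> F)" and v: "v < n"
  shows "den FORCE s ''g'' v =
    of_bool (v \<in> F \<or> (\<exists>u<n. {u, v} \<in> E \<and> u \<in> S \<and> u \<in> T \<and> u \<notin> F))"
proof -
  define G :: "nat \<Rightarrow> nat \<Rightarrow> nat" where "G i v = of_bool (v \<in> F \<or> (\<exists>u<i. {u, v} \<in> E \<and> u \<in> S \<and> u \<in> T \<and> u \<notin> F))"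
    for i v
  have inner: "den (LFor ''u'' ''in'' FORCE_INNER) s1 ''g'' = (s1 ''g'')(v := G n v)"
    if e1: "env s1" and f1: "s1 ''f'' = s ''f''" and v: "s1 ''v'' 0 = v" "v < n" "s1 ''g'' v = s ''f'' v"
    for s1 v
  proof -
    define P :: "nat \<Rightarrow> state \<Rightarrow> bool" where "P = (\<lambda>i t. t ''g'' = (s1 ''g'')(v := G i v))"
    have "P (s1 ''in'' 0) (den (LFor ''u'' ''in'' FORCE_INNER) s1)"
    proof (rule den_LFor_env[OF e1])
      show "P 0 (s1(''u'' := (s1 ''u'')(0 := 0)))" using v f by (auto simp: P_def G_def)
    next
      fix i t assume t: "i < s1 ''in'' 0" "env t" "P i t" "t ''u'' 0 = i"
        "\<And>y. y \<noteq> ''u'' \<Longrightarrow> y \<notin> writes FORCE_INNER \<Longrightarrow> t y = s1 y"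
      have i: "i < n" using t(1) e1 by simp
      have "t ''f'' = s ''f''" "t ''v'' 0 = v"
        using t(5)[of "''f''"] t(5)[of "''v''"] f1 v by (simp_all add: FORCE_INNER_def)
      then show "P (Suc i) ((den FORCE_INNER t)(''u'' := (den FORCE_INNER t ''u'')(0 := Suc i)))"
        using t(2-4) i v(2) f[OF i]
        by (auto simp: P_def FORCE_INNER_def aval_inS aval_inT aval_adj G_def less_Suc_eq)
    qed (simp_all add: FORCE_INNER_def)
    then show ?thesis using e1 by (simp add: P_def)
  qed
  define P :: "nat \<Rightarrow> state \<Rightarrow> bool" where "P = (\<lambda>i t. \<forall>v<i. t ''g'' v = G n v)"
  have w: "writes FORCE_BODY = {''g'', ''u''}" by (auto simp: FORCE_BODY_def FORCE_INNER_def)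
  have "P (s ''in'' 0) (den (LFor ''v'' ''in'' FORCE_BODY) s)"
  proof (rule den_LFor_env[OF env])
    show "P 0 (s(''v'' := (s ''v'')(0 := 0)))" by (simp add: P_def)
  next
    fix i t assume t: "i < s ''in'' 0" "env t" "P i t" "t ''v'' 0 = i"
      "\<And>y. y \<noteq> ''v'' \<Longrightarrow> y \<notin> writes FORCE_BODY \<Longrightarrow> t y = s y"
    have i: "i < n" using t(1) env by simp
    define s1 where "s1 = t(''g'' := (t ''g'')(i := t ''f'' i))"
    have "den (LFor ''u'' ''in'' FORCE_INNER) s1 ''g'' = (s1 ''g'')(i := G n i)"
      by (rule inner) (use t i w in \<open>auto simp: s1_def\<close>)
    then have "den FORCE_BODY t ''g'' = (s1 ''g'')(i := G n i)" using t(4) by (simp add: FORCE_BODY_def s1_def)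
    then show "P (Suc i) ((den FORCE_BODY t)(''v'' := (den FORCE_BODY t ''v'')(0 := Suc i)))"
      using t(3) by (auto simp: P_def s1_def less_Suc_eq)
  qed (simp_all add: w)
  then show ?thesis using v env by (simp add: P_def FORCE_def FORCE_BODY_def FORCE_INNER_def G_def)
qed

section \<open>Correctness of the auction and of the link test\<close>

definition auction_state :: "nat set \<Rightarrow> state \<Rightarrow> bool" where
  "auction_state F s \<longleftrightarrow> auction n (bip F) (s ''p'') (s ''q'') (s ''ow'') (s ''mt'') \<and>
     (\<forall>v<n. s ''g'' v = of_bool (v \<in> F))"

text \<open>The index \<open>i\<close> serves the invariant in the middle of a pass;
  \<open>stable F n\<close> yields \<open>settled\<close>.\<close>

definition stable :: "nat set \<Rightarrow> nat \<Rightarrow> state \<Rightarrow> bool" where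
  "stable F i s \<longleftrightarrow> (\<forall>l<i. l \<in> S \<longrightarrow> l \<notin> T \<longrightarrow> l \<notin> F \<longrightarrow> 0 < s ''mt'' l \<or> n < s ''q'' l)"

text \<open>The progress measure: taking a vertex raises a price, giving up a level raises an offer,
  and neither ever falls.\<close>

definition potential :: "state \<Rightarrow> nat" where
  "potential s = (\<Sum>v<n. s ''p'' v) + (\<Sum>v<n. s ''q'' v)"

definition same_auction :: "state \<Rightarrow> state \<Rightarrow> bool" where
  "same_auction s t \<longleftrightarrow> t ''p'' = s ''p'' \<and> t ''q'' = s ''q'' \<and> t ''ow'' = s ''ow'' \<and> t ''mt'' = s ''mt''"

text \<open>Prices change only when \<open>l\<close> succeeds, after which the scan is idle. Hence
  after a failed scan all its comparisons still hold, which is what \<open>auction_relabel\<close>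
  needs.\<close>

lemma den_BIDS:
  assumes env: "env s" and inv: "auction_state F s"
    and l: "s ''l'' 0 = l" "l < n" "l \<in> S" "l \<notin> T" "l \<notin> F" "s ''mt'' l = 0" "s ''q'' l \<le> n"
  shows "auction_state F (den BIDS s) \<and>
    ((same_auction s (den BIDS s) \<and> (\<forall>r<n. bip F l r \<longrightarrow> s ''p'' r \<noteq> s ''q'' l)) \<or>
     (0 < den BIDS s ''mt'' l \<and> potential s < potential (den BIDS s)))"
proof -
  have w: "writes BIDS_BODY = {''mt'', ''ow'', ''p''}" by (auto simp: BIDS_BODY_def)
  define P :: "nat \<Rightarrow> state \<Rightarrow> bool" where
    "P = (\<lambda>i t. auction_state F t \<and>
      ((same_auction s t \<and> (\<forall>r<i. bip F l r \<longrightarrow> s ''p'' r \<noteq> s ''q'' l)) \<or>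
       (0 < t ''mt'' l \<and> potential s < potential t)))"
  have "P (s ''in'' 0) (den (LFor ''r'' ''in'' BIDS_BODY) s)"
  proof (rule den_LFor_env[OF env])
    show "P 0 (s(''r'' := (s ''r'')(0 := 0)))"
      using inv by (simp add: P_def auction_state_def same_auction_def)
  next
    fix i t assume t: "i < s ''in'' 0" "env t" "P i t" "t ''r'' 0 = i"
      "\<And>y. y \<noteq> ''r'' \<Longrightarrow> y \<notin> writes BIDS_BODY \<Longrightarrow> t y = s y"
    have i: "i < n" using t(1) env by simp
    have fr: "t ''l'' 0 = l" "t ''q'' = s ''q''"
      using t(5)[of "''l''"] t(5)[of "''q''"] l w by simp_all
    have inv_t: "auction n (bip F) (t ''p'') (t ''q'') (t ''ow'') (t ''mt'')"
      and g: "\<And>v. v < n \<Longrightarrow> t ''g'' v = of_bool (v \<in> F)"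
      using t(3) by (auto simp: P_def auction_state_def)
    let ?b = "t ''mt'' l = 0 \<and> bip F l i \<and> t ''p'' i = t ''q'' l"
    have cond: "den BIDS_BODY t = (if ?b then
        t(''mt'' := (if 0 < t ''ow'' i then (t ''mt'')(t ''ow'' i - 1 := 0) else t ''mt'')(l := 1),
          ''ow'' := (t ''ow'')(i := Suc l), ''p'' := (t ''p'')(i := Suc (t ''p'' i))) else t)"
      using i l fr t(2,4) g[OF i]
      by (auto simp: BIDS_BODY_def aval_inS aval_inT aval_adj bip_def fun_upd_twist)
    show "P (Suc i) ((den BIDS_BODY t)(''r'' := (den BIDS_BODY t ''r'')(0 := Suc i)))"
    proof (cases ?b)
      case False
      have "den BIDS_BODY t = t" using cond unfolding if_not_P[OF False] .
      then show ?thesis using t(3) False l(6) fr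
        by (auto simp: P_def auction_state_def same_auction_def potential_def less_Suc_eq)
    next
      case True
      then have same: "same_auction s t" using t(3) by (auto simp: P_def)
      define t' where "t' = den BIDS_BODY t"
      have t': "t' ''p'' = (t ''p'')(i := Suc (t ''p'' i))" "t' ''q'' = t ''q''"
        "t' ''ow'' = (t ''ow'')(i := Suc l)" "t' ''g'' = t ''g''"
        "t' ''mt'' = (if 0 < t ''ow'' i then (t ''mt'')(t ''ow'' i - 1 := 0) else t ''mt'')(l := 1)"
        unfolding t'_def cond[unfolded if_P[OF True]] by simp_all
      have "auction n (bip F) (t' ''p'') (t' ''q'') (t' ''ow'') (t' ''mt'')"
        unfolding t' by (rule auction_take[OF inv_t]) (use True l(7) fr bip_less in auto)
      moreover have "t' ''mt'' l = 1" unfolding t'(5) by simp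
      moreover have "(\<Sum>v<n. t' ''p'' v) = Suc (\<Sum>v<n. t ''p'' v)"
        unfolding t'(1) by (rule sum_upd_Suc[OF i])
      ultimately show ?thesis
        unfolding t'_def[symmetric] using same t'(2,4) g
        by (simp add: P_def auction_state_def same_auction_def potential_def)
    qed
  qed (simp_all add: w)
  then show ?thesis using env by (simp add: P_def BIDS_def BIDS_BODY_def)
qed

text \<open>Every active left vertex raises the potential, by a purchase or by a higher offer. A
  pass that changes nothing thus certifies that it started in a stable state.\<close>

lemma den_PASS:
  assumes env: "env s" and inv: "auction_state F s"
  shows "auction_state F (den PASS s) \<and>
    (potential s < potential (den PASS s) \<and> \<not> stable F n s \<or> same_auction s (den PASS s) \<and> stable F n s)"
proof -
  have w: "writes PASS_BODY = {''r'', ''mt'', ''ow'', ''p'', ''q''}" by (auto simp: PASS_BODY_def BID_RAISE_def)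
  define P :: "nat \<Rightarrow> state \<Rightarrow> bool" where
    "P = (\<lambda>i t. auction_state F t \<and>
      (potential s < potential t \<and> \<not> stable F n s \<or> same_auction s t \<and> stable F i s))"
  have "P (s ''in'' 0) (den (LFor ''l'' ''in'' PASS_BODY) s)"
  proof (rule den_LFor_env[OF env])
    show "P 0 (s(''l'' := (s ''l'')(0 := 0)))"
      using inv by (simp add: P_def auction_state_def same_auction_def stable_def)
  next
    fix l t assume t: "l < s ''in'' 0" "env t" "P l t" "t ''l'' 0 = l"
    have l: "l < n" using t(1) env by simp
    have inv_t: "auction_state F t" using t(3) by (simp add: P_def)
    then have g: "t ''g'' l = of_bool (l \<in> F)" using l by (simp add: auction_state_def)
    let ?b = "l \<in> S \<and> l \<notin> T \<and> l \<notin> F \<and> t ''mt'' l = 0 \<and> t ''q'' l \<le> n"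
    have cond: "den PASS_BODY t = (if ?b then den BID_RAISE t else t)"
      using l t(2,4) g by (simp add: PASS_BODY_def aval_inS aval_inT less_Suc_eq_le)
    show "P (Suc l) ((den PASS_BODY t)(''l'' := (den PASS_BODY t ''l'')(0 := Suc l)))"
    proof (cases ?b)
      case False
      have "den PASS_BODY t = t" using cond unfolding if_not_P[OF False] .
      then show ?thesis using t(3) False
        by (auto simp: P_def auction_state_def same_auction_def potential_def stable_def less_Suc_eq)
    next
      case True
      define t1 where "t1 = den BIDS t"
      have t1: "auction_state F t1"
        "same_auction t t1 \<and> (\<forall>r<n. bip F l r \<longrightarrow> t ''p'' r \<noteq> t ''q'' l) \<or>
          0 < t1 ''mt'' l \<and> potential t < potential t1"
      proof -
        have "l \<in> S" "l \<notin> T" "l \<notin> F" "t ''mt'' l = 0" "t ''q'' l \<le> n" using True by simp_all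
        from den_BIDS[OF t(2) inv_t t(4) l this] show "auction_state F t1"
          "same_auction t t1 \<and> (\<forall>r<n. bip F l r \<longrightarrow> t ''p'' r \<noteq> t ''q'' l) \<or>
            0 < t1 ''mt'' l \<and> potential t < potential t1"
          unfolding t1_def by simp_all
      qed
      have t1l: "t1 ''l'' 0 = l" using t(4) by (simp add: t1_def den_frame)
      have raise: "auction_state F (den BID_RAISE t) \<and> potential t < potential (den BID_RAISE t)"
      proof (cases "t1 ''mt'' l = 0")
        case False
        then have "den BID_RAISE t = t1" "potential t < potential t1"
          using t1l t1(2) True by (auto simp: BID_RAISE_def t1_def same_auction_def)
        then show ?thesis using t1 by simp
      next
        case mt: True
        then have same: "same_auction t t1" "\<forall>r<n. bip F l r \<longrightarrow> t ''p'' r \<noteq> t ''q'' l"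
          using t1(2) by auto
        define t' where "t' = den BID_RAISE t"
        have "t' = t1(''q'' := (t1 ''q'')(l := Suc (t1 ''q'' l)))"
          using mt t1l by (simp add: t'_def BID_RAISE_def t1_def)
        then have t': "t' ''q'' = (t1 ''q'')(l := Suc (t1 ''q'' l))" "t' ''p'' = t1 ''p''"
          "t' ''ow'' = t1 ''ow''" "t' ''mt'' = t1 ''mt''" "t' ''g'' = t1 ''g''" by simp_all
        have "auction n (bip F) (t' ''p'') (t' ''q'') (t' ''ow'') (t' ''mt'')"
          unfolding t' by (rule auction_relabel)
            (use t1(1) mt same True bip_less in \<open>auto simp: auction_state_def same_auction_def\<close>)
        moreover have "(\<Sum>v<n. t' ''q'' v) = Suc (\<Sum>v<n. t1 ''q'' v)"
          unfolding t'(1) by (rule sum_upd_Suc[OF l])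
        ultimately show ?thesis
          unfolding t'_def[symmetric] using t1(1) same(1) t'(2,5)
          by (simp add: auction_state_def potential_def same_auction_def)
      qed
      \<comment> \<open>If nothing has changed since the start of the pass, \<open>l\<close> was
        active in \<open>s\<close> as well, so \<open>s\<close> was not stable.\<close>
      moreover have "potential s \<le> potential t \<and> \<not> stable F n s"
        using t(3) True l by (auto simp: P_def stable_def same_auction_def potential_def)
      ultimately show ?thesis
        using cond True by (auto simp: P_def auction_state_def potential_def)
    qed
  qed (simp_all add: w)
  then show ?thesis using env by (simp add: P_def PASS_def PASS_BODY_def BID_RAISE_def)
qed

text \<open>After \<open>i\<close> passes the potential is at least \<open>i\<close> or the state is
  stable. The first alternative fails for \<open>i = K\<close>, as the caps on prices and offers
  keep the potential below \<open>K\<close>.\<close>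

lemma den_AUCTION:
  assumes env: "env s" and g: "\<And>v. v < n \<Longrightarrow> s ''g'' v = of_bool (v \<in> F)"
  shows "auction_state F (den AUCTION s) \<and> stable F n (den AUCTION s)"
proof -
  define Z :: "nat \<Rightarrow> state \<Rightarrow> bool" where
    "Z = (\<lambda>i t. \<forall>v<i. t ''p'' v = 0 \<and> t ''q'' v = 0 \<and> t ''ow'' v = 0 \<and> t ''mt'' v = 0)"
  have "Z (s ''in'' 0) (den CLEAR_AUCTION s)"
    unfolding CLEAR_AUCTION_def
    by (rule den_LFor_env[OF env]) (auto simp: Z_def less_Suc_eq)
  then have Z: "Z n (den CLEAR_AUCTION s)" using env by simp
  have env1: "env (den CLEAR_AUCTION s)" using env by (simp add: CLEAR_AUCTION_def env_den)
  have "den CLEAR_AUCTION s ''g'' = s ''g''" by (simp add: CLEAR_AUCTION_def den_frame)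
  then have inv: "auction_state F (den CLEAR_AUCTION s)"
    using Z g by (auto simp: auction_state_def Z_def intro!: auction_init dest: bip_less)
  define P :: "nat \<Rightarrow> state \<Rightarrow> bool" where
    "P = (\<lambda>i t. auction_state F t \<and> (i \<le> potential t \<or> stable F n t))"
  have "P (den CLEAR_AUCTION s ''K'' 0) (den (LFor ''a'' ''K'' PASS) (den CLEAR_AUCTION s))"
  proof (rule den_LFor_env[OF env1])
    show "P 0 ((den CLEAR_AUCTION s)(''a'' := (den CLEAR_AUCTION s ''a'')(0 := 0)))"
      using inv by (simp add: P_def auction_state_def)
  next
    fix i t assume "env t" "P i t"
    then show "P (Suc i) ((den PASS t)(''a'' := (den PASS t ''a'')(0 := Suc i)))"
      using den_PASS[of t F]
      by (auto simp: P_def auction_state_def potential_def stable_def same_auction_def)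
  qed simp_all
  then have *: "auction_state F (den AUCTION s)"
    "2 * n * (n + 1) + 1 \<le> potential (den AUCTION s) \<or> stable F n (den AUCTION s)"
    using env1 by (simp_all add: P_def AUCTION_def CLEAR_AUCTION_def)
  have "\<And>v. v < n \<Longrightarrow> den AUCTION s ''p'' v \<le> Suc n \<and> den AUCTION s ''q'' v \<le> Suc n"
    using *(1) by (simp add: auction_state_def auction_def)
  then have "(\<Sum>v<n. den AUCTION s ''p'' v) \<le> n * Suc n" "(\<Sum>v<n. den AUCTION s ''q'' v) \<le> n * Suc n"
    using sum_bounded_above[of "{..<n}" _ "Suc n"] by fastforce+
  then have "potential (den AUCTION s) \<le> 2 * n * (n + 1)" by (simp add: potential_def)
  then show ?thesis using * by auto
qed

lemma den_COUNT:
  assumes env: "env s" and g: "\<And>v. v < n \<Longrightarrow> s ''g'' v = of_bool (v \<in> F)" and F: "F \<subseteq> {..<n}"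
  shows "den COUNT s ''res'' 0 = of_bool (card F + card {r. r < n \<and> 0 < s ''ow'' r} \<le> card S)"
proof -
  define s0 where "s0 = s(''cnt'' := (s ''cnt'')(0 := 0))"
  have env0: "env s0" using env by (simp add: s0_def)
  define P :: "nat \<Rightarrow> state \<Rightarrow> bool" where
    "P = (\<lambda>i t. t ''cnt'' 0 = card {v. v < i \<and> v \<in> F} + card {r. r < i \<and> 0 < s ''ow'' r})"
  define s1 where "s1 = den (LFor ''v'' ''in'' COUNT_BODY) s0"
  have "P (s0 ''in'' 0) s1"
    unfolding s1_def
  proof (rule den_LFor_env[OF env0])
    show "P 0 (s0(''v'' := (s0 ''v'')(0 := 0)))" by (simp add: P_def s0_def)
  next
    fix i t assume t: "i < s0 ''in'' 0" "env t" "P i t" "t ''v'' 0 = i"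
      "\<And>y. y \<noteq> ''v'' \<Longrightarrow> y \<notin> writes COUNT_BODY \<Longrightarrow> t y = s0 y"
    have i: "i < n" using t(1) env0 by simp
    have "t ''g'' i = of_bool (i \<in> F)" "t ''ow'' = s ''ow''"
      using t(5)[of "''g''"] t(5)[of "''ow''"] g[OF i] by (simp_all add: COUNT_BODY_def s0_def)
    then show "P (Suc i) ((den COUNT_BODY t)(''v'' := (den COUNT_BODY t ''v'')(0 := Suc i)))"
      using t(3,4) by (simp add: P_def COUNT_BODY_def card_less_Suc)
  qed (simp_all add: COUNT_BODY_def)
  moreover have "{v. v < n \<and> v \<in> F} = F" using F by auto
  moreover have "env s1" using env0 by (simp add: s1_def env_den COUNT_BODY_def)
  ultimately show ?thesis
    using env0 by (auto simp: COUNT_def s1_def s0_def COUNT_BODY_def P_def)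
qed

text \<open>The number \<open>m\<close> of owned vertices bounds every cover from below
  (\<open>auction_le_cover\<close>) and is attained up to \<le> by some cover
  (\<open>settled_cover\<close>), so comparing \<open>m\<close> with the remaining budget is
  exact.\<close>

lemma den_TEST:
  assumes env: "env s" and c: "s ''c'' 0 < n ^ mu" "s ''d'' 0 < n ^ mu" "s ''e'' 0 < n ^ mu"
  shows "den TEST s ''res'' 0 = of_bool (test (s ''c'' 0) (s ''d'' 0) (s ''e'' 0))"
proof -
  let ?F = "forced (s ''c'' 0) (s ''d'' 0) (s ''e'' 0)"
  define s1 where "s1 = den CLEAR s"
  define s2 where "s2 = den (DECODE ''c'') s1"
  define s3 where "s3 = den (DECODE ''d'') s2"
  define s4 where "s4 = den (DECODE ''e'') s3"
  define s5 where "s5 = den FORCE s4"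
  define s6 where "s6 = den AUCTION s5"
  have e: "env s1" "env s2" "env s3" "env s4" "env s5" "env s6"
    using env by (simp_all add: s1_def s2_def s3_def s4_def s5_def s6_def env_den)
  have "s1 ''c'' = s ''c''" "s2 ''d'' = s ''d''" "s3 ''e'' = s ''e''"
    by (simp_all add: s1_def s2_def s3_def den_frame)
  then have f: "s4 ''f'' v =
      of_bool (v \<in> code_set (s ''c'' 0) \<union> code_set (s ''d'' 0) \<union> code_set (s ''e'' 0))"
    if "v < n" for v
    using c that den_DECODE[OF e(1), of "''c''"] den_DECODE[OF e(2), of "''d''"] den_DECODE[OF e(3), of "''e''"] den_CLEAR[OF env, of v]
    by (simp add: s4_def s3_def s2_def s1_def)
  have g: "s5 ''g'' v = of_bool (v \<in> ?F)" if "v < n" for v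
    using den_FORCE[OF e(4) f that] that by (simp add: s5_def forced_def Let_def)
  have A: "auction_state ?F s6" "stable ?F n s6"
    using den_AUCTION[OF e(5) g] by (simp_all add: s6_def)
  have sub: "?F \<subseteq> {..<n}" using forced_subset c by blast
  define m where "m = card {r. r < n \<and> 0 < s6 ''ow'' r}"
  have res: "den TEST s ''res'' 0 = of_bool (card ?F + m \<le> card S)"
    using den_COUNT[OF e(6) _ sub] A(1)
    by (simp add: TEST_def auction_state_def s6_def s5_def s4_def s3_def s2_def s1_def m_def)
  have inv: "auction n (bip ?F) (s6 ''p'') (s6 ''q'') (s6 ''ow'') (s6 ''mt'')"
    using A(1) by (simp add: auction_state_def)
  have fin: "settled n (bip ?F) (s6 ''q'') (s6 ''mt'')"
    using A(2) bip_less unfolding settled_def stable_def by (auto simp: bip_def)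
  have "\<exists>C. edge_cover (bip ?F) C \<and> C \<subseteq> {v. \<exists>w. bip ?F v w \<or> bip ?F w v} \<and> card C \<le> m"
    unfolding m_def by (rule settled_cover[OF inv fin]) (rule bip_less)
  then obtain C where C: "edge_cover (bip ?F) C" "C \<subseteq> {v. \<exists>w. bip ?F v w \<or> bip ?F w v}" "card C \<le> m"
    by blast
  have "C \<subseteq> {..<n}" using C(2) bip_less by blast
  then have "card ?F + m \<le> card S \<Longrightarrow> test (s ''c'' 0) (s ''d'' 0) (s ''e'' 0)"
    unfolding test_def using C(1,3) by (intro exI[of _ C]) auto
  moreover have "card ?F + m \<le> card S" if pos: "test (s ''c'' 0) (s ''d'' 0) (s ''e'' 0)"
  proof -
    obtain C where C: "edge_cover (bip ?F) C" "card ?F + card C \<le> card S"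
      using pos by (auto simp: test_def)
    have "m \<le> card C"
      unfolding m_def by (rule auction_le_cover[OF inv C(1)]) (auto simp: bip_def)
    then show ?thesis using C(2) by linarith
  qed
  ultimately show ?thesis using res by auto
qed

lemma den_LINK:
  assumes env: "env s" and c: "s ''c'' 0 < n ^ mu" "s ''d'' 0 < n ^ mu"
  shows "den LINK s ''ex'' 0 = of_bool (\<exists>e < n ^ mu. test (s ''c'' 0) (s ''d'' 0) e)"
proof -
  define s0 where "s0 = s(''ex'' := (s ''ex'')(0 := 0))"
  have env0: "env s0" using env by (simp add: s0_def)
  define P :: "nat \<Rightarrow> state \<Rightarrow> bool" where
    "P = (\<lambda>i t. t ''ex'' 0 = of_bool (\<exists>e<i. test (s ''c'' 0) (s ''d'' 0) e))"
  have "P (s0 ''N'' 0) (den (LFor ''e'' ''N'' LINK_BODY) s0)"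
  proof (rule den_LFor_env[OF env0])
    show "P 0 (s0(''e'' := (s0 ''e'')(0 := 0)))" by (simp add: P_def s0_def)
  next
    fix i t assume t: "i < s0 ''N'' 0" "env t" "P i t" "t ''e'' 0 = i"
      "\<And>y. y \<noteq> ''e'' \<Longrightarrow> y \<notin> writes LINK_BODY \<Longrightarrow> t y = s0 y"
    have i: "i < n ^ mu" using t(1) env0 by simp
    have cd: "t ''c'' 0 = s ''c'' 0" "t ''d'' 0 = s ''d'' 0"
      using t(5)[of "''c''"] t(5)[of "''d''"] by (simp_all add: LINK_BODY_def s0_def)
    have "den TEST t ''res'' 0 = of_bool (test (s ''c'' 0) (s ''d'' 0) i)"
      using den_TEST[OF t(2)] cd c i t(4) by simp
    moreover have "den TEST t ''ex'' = t ''ex''" by (simp add: den_frame)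
    ultimately show "P (Suc i) ((den LINK_BODY t)(''e'' := (den LINK_BODY t ''e'')(0 := Suc i)))"
      using t(3) by (auto simp: P_def LINK_BODY_def less_Suc_eq)
  qed (simp_all add: LINK_BODY_def)
  then show ?thesis using env0 by (simp add: P_def LINK_def LINK_BODY_def s0_def)
qed

section \<open>Closure of the marked codes\<close>

definition valid :: "nat \<Rightarrow> bool" where
  "valid c \<longleftrightarrow> card (code_set c) = mu"

definition succ :: "nat \<Rightarrow> nat \<Rightarrow> bool" where
  "succ c d \<longleftrightarrow> d < n ^ mu \<and> valid d \<and> (\<exists>e < n ^ mu. test c d e)"

definition marked :: "state \<Rightarrow> nat set" where
  "marked s = {c. c < n ^ mu \<and> 0 < s ''mark'' c}"

definition valid_table :: "state \<Rightarrow> bool" where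
  "valid_table s \<longleftrightarrow> (\<forall>d < n ^ mu. s ''vd'' d = of_bool (valid d))"

lemma den_CLOSE_ROW:
  assumes env: "env s" and c: "s ''c'' 0 = c" "c < n ^ mu" and vd: "valid_table s"
  shows "marked (den CLOSE_ROW s) = marked s \<union> {d. c \<in> marked s \<and> succ c d}"
proof -
  define P :: "nat \<Rightarrow> state \<Rightarrow> bool" where
    "P = (\<lambda>i t. marked t = marked s \<union> {d. d < i \<and> c \<in> marked s \<and> succ c d})"
  have "P (s ''N'' 0) (den (LFor ''d'' ''N'' CLOSE_ROW_BODY) s)"
  proof (rule den_LFor_env[OF env])
    show "P 0 (s(''d'' := (s ''d'')(0 := 0)))" by (simp add: P_def marked_def)
  next
    fix i t assume t: "i < s ''N'' 0" "env t" "P i t" "t ''d'' 0 = i"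
      "\<And>y. y \<noteq> ''d'' \<Longrightarrow> y \<notin> writes CLOSE_ROW_BODY \<Longrightarrow> t y = s y"
    have i: "i < n ^ mu" using t(1) env by simp
    have cc: "t ''c'' 0 = c" "t ''vd'' i = of_bool (valid i)"
      using t(5)[of "''c''"] t(5)[of "''vd''"] c vd i by (simp_all add: CLOSE_ROW_BODY_def valid_table_def)
    define u where "u = den LINK t"
    have u: "u ''c'' 0 = c" "u ''d'' 0 = i" "u ''vd'' i = of_bool (valid i)" "u ''mark'' = t ''mark''"
      using cc t(4) by (simp_all add: u_def den_frame)
    have "u ''ex'' 0 = of_bool (\<exists>e < n ^ mu. test c i e)"
      using den_LINK[OF t(2)] cc t(4) c i by (simp add: u_def)
    then have "0 < u ''ex'' 0 \<and> 0 < u ''vd'' i \<longleftrightarrow> succ c i"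
      using u i by (auto simp: succ_def)
    \<comment> \<open>An unmarked \<open>c\<close> marks nothing in its row, in particular not
      itself, so its status is constant during the row.\<close>
    moreover have "0 < t ''mark'' c \<longleftrightarrow> c \<in> marked s"
      using t(3) c(2) by (auto simp: P_def marked_def)
    moreover have "den CLOSE_ROW_BODY t = (if 0 < u ''mark'' c \<and> 0 < u ''vd'' i \<and> 0 < u ''ex'' 0
        then u(''mark'' := (u ''mark'')(i := 1)) else u)"
      using u by (simp add: CLOSE_ROW_BODY_def u_def)
    ultimately have "marked (den CLOSE_ROW_BODY t) = marked t \<union> {d. d = i \<and> c \<in> marked s \<and> succ c i}"
      using u i by (auto simp: marked_def)
    then have "marked (den CLOSE_ROW_BODY t) = marked s \<union> {d. d < Suc i \<and> c \<in> marked s \<and> succ c d}"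
      using t(3) by (auto simp: P_def less_Suc_eq)
    then show "P (Suc i) ((den CLOSE_ROW_BODY t)(''d'' := (den CLOSE_ROW_BODY t ''d'')(0 := Suc i)))"
      by (simp add: P_def marked_def)
  qed (simp_all add: CLOSE_ROW_BODY_def)
  then have "marked (den CLOSE_ROW s) = marked s \<union> {d. d < n ^ mu \<and> c \<in> marked s \<and> succ c d}"
    using env by (simp add: P_def CLOSE_ROW_def CLOSE_ROW_BODY_def)
  then show ?thesis by (auto simp: succ_def)
qed

definition succ_closed :: "nat set \<Rightarrow> bool" where
  "succ_closed Q \<longleftrightarrow> (\<forall>c d. c \<in> Q \<longrightarrow> c < n ^ mu \<longrightarrow> succ c d \<longrightarrow> d \<in> Q)"

text \<open>Marks set in one row may already be used by later rows, so a pass can advance several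
  steps. It is therefore described by a lower bound and by leastness among closed supersets, not by
  an equation.\<close>

lemma den_CLOSE_PASS:
  assumes env: "env s" and vd: "valid_table s"
  defines "M \<equiv> marked (den CLOSE_PASS s)"
  shows "marked s \<subseteq> M" "\<And>c d. c \<in> marked s \<Longrightarrow> succ c d \<Longrightarrow> d \<in> M"
    "\<And>Q. marked s \<subseteq> Q \<Longrightarrow> succ_closed Q \<Longrightarrow> M \<subseteq> Q"
proof -
  define P :: "nat \<Rightarrow> state \<Rightarrow> bool" where
    "P = (\<lambda>i t. marked s \<subseteq> marked t \<and> (\<forall>c d. c < i \<longrightarrow> c \<in> marked s \<longrightarrow> succ c d \<longrightarrow> d \<in> marked t) \<and>
       (\<forall>Q. marked s \<subseteq> Q \<longrightarrow> succ_closed Q \<longrightarrow> marked t \<subseteq> Q))"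
  have "P (s ''N'' 0) (den (LFor ''c'' ''N'' CLOSE_ROW) s)"
  proof (rule den_LFor_env[OF env])
    show "P 0 (s(''c'' := (s ''c'')(0 := 0)))" by (simp add: P_def marked_def)
  next
    fix i t assume t: "i < s ''N'' 0" "env t" "P i t" "t ''c'' 0 = i"
      "\<And>y. y \<noteq> ''c'' \<Longrightarrow> y \<notin> writes CLOSE_ROW \<Longrightarrow> t y = s y"
    have i: "i < n ^ mu" using t(1) env by simp
    have "valid_table t" using vd t(5)[of "''vd''"] by (simp add: valid_table_def)
    then have row: "marked (den CLOSE_ROW t) = marked t \<union> {d. i \<in> marked t \<and> succ i d}"
      using den_CLOSE_ROW[OF t(2,4) i] by simp
    define M' where "M' = marked (den CLOSE_ROW t)"
    have M': "M' = marked t \<union> {d. i \<in> marked t \<and> succ i d}" by (simp add: M'_def row)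
    have IH: "marked s \<subseteq> marked t" "\<And>c d. c < i \<Longrightarrow> c \<in> marked s \<Longrightarrow> succ c d \<Longrightarrow> d \<in> marked t"
      "\<And>Q. marked s \<subseteq> Q \<Longrightarrow> succ_closed Q \<Longrightarrow> marked t \<subseteq> Q"
      using t(3) by (auto simp: P_def)
    have "marked s \<subseteq> M'" using IH(1) M' by blast
    moreover have "d \<in> M'" if "c < Suc i" "c \<in> marked s" "succ c d" for c d
    proof (cases "c = i")
      case True
      then show ?thesis using that IH(1) unfolding M' by blast
    next
      case False
      then show ?thesis using that IH(2)[of c d] unfolding M' by simp
    qed
    moreover have "M' \<subseteq> Q" if "marked s \<subseteq> Q" "succ_closed Q" for Q
      using IH(3)[OF that] that(2) i unfolding M' succ_closed_def by blast
    moreover have "marked ((den CLOSE_ROW t)(''c'' := x)) = M'" for x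
      by (simp add: marked_def M'_def)
    ultimately show "P (Suc i) ((den CLOSE_ROW t)(''c'' := (den CLOSE_ROW t ''c'')(0 := Suc i)))"
      by (simp add: P_def)
  qed simp_all
  then have "P (n ^ mu) (den CLOSE_PASS s)" using env by (simp add: CLOSE_PASS_def)
  then show "marked s \<subseteq> M" "\<And>c d. c \<in> marked s \<Longrightarrow> succ c d \<Longrightarrow> d \<in> M"
    "\<And>Q. marked s \<subseteq> Q \<Longrightarrow> succ_closed Q \<Longrightarrow> M \<subseteq> Q"
    unfolding P_def M_def by (auto simp: marked_def)
qed

text \<open>A pass from a set that is not closed adds an element; leastness, applied to a closed set
  itself, shows that it is left fixed.\<close>

lemma den_CLOSE:
  assumes env: "env s" and vd: "valid_table s"
  defines "M \<equiv> marked (den CLOSE s)"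
  shows "marked s \<subseteq> M" "succ_closed M" "\<And>Q. marked s \<subseteq> Q \<Longrightarrow> succ_closed Q \<Longrightarrow> M \<subseteq> Q"
proof -
  have fin: "finite (marked t)" "marked t \<subseteq> {..<n ^ mu}" for t by (auto simp: marked_def)
  define P :: "nat \<Rightarrow> state \<Rightarrow> bool" where
    "P = (\<lambda>i t. marked s \<subseteq> marked t \<and> (\<forall>Q. marked s \<subseteq> Q \<longrightarrow> succ_closed Q \<longrightarrow> marked t \<subseteq> Q) \<and>
       (i \<le> card (marked t) \<or> succ_closed (marked t)))"
  have "P (s ''N'' 0) (den (LFor ''it'' ''N'' CLOSE_PASS) s)"
  proof (rule den_LFor_env[OF env])
    show "P 0 (s(''it'' := (s ''it'')(0 := 0)))" by (simp add: P_def marked_def)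
  next
    fix i t assume t: "env t" "P i t" "\<And>y. y \<noteq> ''it'' \<Longrightarrow> y \<notin> writes CLOSE_PASS \<Longrightarrow> t y = s y"
    have "valid_table t" using vd t(3)[of "''vd''"] by (simp add: valid_table_def)
    note pass = den_CLOSE_PASS[OF t(1) this]
    define M' where "M' = marked (den CLOSE_PASS t)"
    have "Suc i \<le> card M' \<or> succ_closed M'"
    proof (cases "succ_closed (marked t)")
      case True
      then have "M' = marked t" using pass(1,3) by (auto simp: M'_def)
      then show ?thesis using True by simp
    next
      case False
      then have "marked t \<subset> M'"
        using pass(1,2) unfolding succ_closed_def M'_def by blast
      then have "card (marked t) < card M'" using fin(1) by (simp add: M'_def psubset_card_mono)
      then show ?thesis using t(2) False by (auto simp: P_def)
    qed
    moreover have "marked ((den CLOSE_PASS t)(''it'' := x)) = M'" for x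
      by (simp add: marked_def M'_def)
    moreover have "marked s \<subseteq> M'" using t(2) pass(1) by (auto simp: P_def M'_def)
    moreover have "M' \<subseteq> Q" if "marked s \<subseteq> Q" "succ_closed Q" for Q
      using t(2) pass(3)[of Q] that by (auto simp: P_def M'_def)
    ultimately show "P (Suc i) ((den CLOSE_PASS t)(''it'' := (den CLOSE_PASS t ''it'')(0 := Suc i)))"
      by (simp add: P_def)
  qed simp_all
  then have *: "P (n ^ mu) (den CLOSE s)"
    using env by (simp add: CLOSE_def)
  then show "marked s \<subseteq> M" "\<And>Q. marked s \<subseteq> Q \<Longrightarrow> succ_closed Q \<Longrightarrow> M \<subseteq> Q"
    unfolding P_def M_def by auto
  have "succ_closed M" if "n ^ mu \<le> card M"
  proof -
    \<comment> \<open>The growth alternative can survive all passes only if every code is marked,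
      and the set of all codes is closed.\<close>
    have "M = {..<n ^ mu}"
      using that fin(2)[of "den CLOSE s"] by (intro card_seteq) (simp_all add: M_def)
    then show ?thesis by (auto simp: succ_closed_def succ_def)
  qed
  then show "succ_closed M" using * unfolding P_def M_def by auto
qed

lemma den_INIT:
  assumes env: "env s" and c: "c < n ^ mu"
  shows "den INIT s ''vd'' c = of_bool (valid c)"
    "den INIT s ''mark'' c = of_bool (valid c \<and> code_set c \<subseteq> S)"
    "den INIT s ''tg'' c = of_bool (valid c \<and> code_set c \<subseteq> T)"
proof -
  define P :: "nat \<Rightarrow> state \<Rightarrow> bool" where
    "P = (\<lambda>i t. \<forall>c<i. t ''vd'' c = of_bool (valid c) \<and>
       t ''mark'' c = of_bool (valid c \<and> code_set c \<subseteq> S) \<and> t ''tg'' c = of_bool (valid c \<and> code_set c \<subseteq> T))"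
  have "P (s ''N'' 0) (den (LFor ''c'' ''N'' INIT_BODY) s)"
  proof (rule den_LFor_env[OF env])
    show "P 0 (s(''c'' := (s ''c'')(0 := 0)))" by (simp add: P_def)
  next
    fix i t assume t: "i < s ''N'' 0" "env t" "P i t" "t ''c'' 0 = i"
    have i: "i < n ^ mu" using t(1) env by simp
    define u where "u = den (INSPECT ''c'') t"
    have u: "u ''cnt'' 0 = card (code_set i)" "u ''sS'' 0 = of_bool (code_set i \<subseteq> S)"
      "u ''sT'' 0 = of_bool (code_set i \<subseteq> T)"
      using den_INSPECT[OF t(2), of "''c''"] t(4) i by (simp_all add: u_def)
    have fr: "u ''c'' 0 = i" "u ''vd'' = t ''vd''" "u ''mark'' = t ''mark''" "u ''tg'' = t ''tg''"
      using t(4) by (simp_all add: u_def den_frame)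
    have "env u" using t(2) by (simp add: u_def env_den)
    then have "den INIT_BODY t = (if valid i
        then u(''vd'' := (u ''vd'')(i := 1), ''mark'' := (u ''mark'')(i := of_bool (code_set i \<subseteq> S)),
          ''tg'' := (u ''tg'')(i := of_bool (code_set i \<subseteq> T)))
        else u(''vd'' := (u ''vd'')(i := 0), ''mark'' := (u ''mark'')(i := 0), ''tg'' := (u ''tg'')(i := 0)))"
      using u fr by (auto simp: INIT_BODY_def u_def valid_def fun_upd_twist)
    then show "P (Suc i) ((den INIT_BODY t)(''c'' := (den INIT_BODY t ''c'')(0 := Suc i)))"
      using t(3) fr by (auto simp: P_def less_Suc_eq)
  qed (simp_all add: INIT_BODY_def)
  then have "P (n ^ mu) (den INIT s)" using env by (simp add: INIT_def INIT_BODY_def)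
  then show "den INIT s ''vd'' c = of_bool (valid c)"
    "den INIT s ''mark'' c = of_bool (valid c \<and> code_set c \<subseteq> S)"
    "den INIT s ''tg'' c = of_bool (valid c \<and> code_set c \<subseteq> T)"
    using c by (auto simp: P_def)
qed

lemma den_FINAL:
  assumes env: "env s"
  shows "den FINAL s ''out'' 0 = of_bool (\<exists>c < n ^ mu. 0 < s ''mark'' c \<and> 0 < s ''tg'' c)"
proof -
  define s0 where "s0 = s(''out'' := (s ''out'')(0 := 0))"
  have env0: "env s0" using env by (simp add: s0_def)
  define P :: "nat \<Rightarrow> state \<Rightarrow> bool" where
    "P = (\<lambda>i t. t ''out'' 0 = of_bool (\<exists>c<i. 0 < s ''mark'' c \<and> 0 < s ''tg'' c))"
  have "P (s0 ''N'' 0) (den (LFor ''c'' ''N'' FINAL_BODY) s0)"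
  proof (rule den_LFor_env[OF env0])
    show "P 0 (s0(''c'' := (s0 ''c'')(0 := 0)))" by (simp add: P_def s0_def)
  next
    fix i t assume t: "P i t" "t ''c'' 0 = i"
      "\<And>y. y \<noteq> ''c'' \<Longrightarrow> y \<notin> writes FINAL_BODY \<Longrightarrow> t y = s0 y"
    have "t ''mark'' = s ''mark''" "t ''tg'' = s ''tg''"
      using t(3)[of "''mark''"] t(3)[of "''tg''"] by (simp_all add: FINAL_BODY_def s0_def)
    then show "P (Suc i) ((den FINAL_BODY t)(''c'' := (den FINAL_BODY t ''c'')(0 := Suc i)))"
      using t(1,2) by (auto simp: P_def FINAL_BODY_def less_Suc_eq)
  qed (simp_all add: FINAL_BODY_def)
  then show ?thesis using env0 by (simp add: P_def FINAL_def FINAL_BODY_def s0_def)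
qed

text \<open>Soundness is leastness applied to \<open>Collect good\<close>, which is closed by
  \<open>test_sound\<close> and \<open>good_step\<close>; completeness uses that the marked set
  itself is closed.\<close>

lemma den_MAIN:
  assumes env: "env s"
  shows "den MAIN s ''out'' 0 = of_bool (reachable T)"
proof -
  define s1 where "s1 = den INIT s"
  define s2 where "s2 = den CLOSE s1"
  have e1: "env s1" using env by (simp add: s1_def env_den INIT_def INIT_BODY_def)
  have e2: "env s2" using e1 by (simp add: s2_def env_den CLOSE_def)
  note init = den_INIT[OF env, folded s1_def]
  have "valid_table s1" using init(1) by (simp add: valid_table_def)
  note close = den_CLOSE[OF e1 this, folded s2_def]
  have m1: "marked s1 = {c. c < n ^ mu \<and> valid c \<and> code_set c \<subseteq> S}"
    using init(2) by (auto simp: marked_def)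
  have "succ_closed (Collect good)"
    unfolding succ_closed_def succ_def valid_def using good_step test_sound by blast
  moreover have "marked s1 \<subseteq> Collect good" unfolding m1 using good_init by (auto simp: valid_def)
  ultimately have good: "marked s2 \<subseteq> Collect good" using close(3) by blast
  have "reachable T \<longleftrightarrow> (\<exists>c < n ^ mu. c \<in> marked s2 \<and> card (code_set c) = mu \<and> code_set c \<subseteq> T)"
  proof (rule reachable_iff_marked)
    fix c assume "c < n ^ mu" "card (code_set c) = mu" "code_set c \<subseteq> S"
    then show "c \<in> marked s2" using close(1) m1 by (auto simp: valid_def)
  next
    fix c d e
    assume "c \<in> marked s2" "c < n ^ mu" "d < n ^ mu" "e < n ^ mu" "card (code_set d) = mu" "test c d e"
    then show "d \<in> marked s2" using close(2) unfolding succ_closed_def succ_def valid_def by blast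
  qed (use good in blast)
  moreover have "s2 ''tg'' = s1 ''tg''" by (simp add: s2_def CLOSE_def den_frame)
  ultimately show ?thesis
    using den_FINAL[OF e2] init(3) by (auto simp: MAIN_def s2_def s1_def marked_def valid_def)
qed

section \<open>Correctness of the preprocessing\<close>

definition sized :: "state \<Rightarrow> bool" where
  "sized s \<longleftrightarrow> s ''in'' = inp \<and> s ''s'' 0 = card S \<and> s ''mu'' 0 = mu"

lemma den_SIZES:
  assumes s: "s ''in'' = inp"
  shows "sized (den SIZES s)"
proof -
  define s0 where "s0 = s(''s'' := (s ''s'')(0 := 0))"
  define P :: "nat \<Rightarrow> state \<Rightarrow> bool" where
    "P = (\<lambda>i t. t ''s'' 0 = card {v. v < i \<and> v \<in> S})"
  define s1 where "s1 = den (LFor ''v'' ''in'' SIZES_BODY) s0"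
  have "P (s0 ''in'' 0) s1"
    unfolding s1_def
  proof (rule den_LFor_induct)
    show "P 0 (s0(''v'' := (s0 ''v'')(0 := 0)))" by (simp add: P_def s0_def)
  next
    fix i t assume t: "i < s0 ''in'' 0" "P i t" "t ''v'' 0 = i"
      "\<And>y. y \<noteq> ''v'' \<Longrightarrow> y \<notin> writes SIZES_BODY \<Longrightarrow> t y = s0 y"
    have "i < n" using t(1) s by (simp add: s0_def)
    moreover have "t ''in'' = inp" using t(4)[of "''in''"] s by (simp add: SIZES_BODY_def s0_def)
    ultimately show "P (Suc i) ((den SIZES_BODY t)(''v'' := (den SIZES_BODY t ''v'')(0 := Suc i)))"
      using t(2,3) by (simp add: P_def SIZES_BODY_def inS_def inp_S card_less_Suc)
  qed (simp_all add: SIZES_BODY_def)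
  moreover have "{v. v < n \<and> v \<in> S} = S" using S_sub by auto
  moreover have "s1 ''in'' = inp" using s by (simp add: s1_def s0_def den_frame SIZES_BODY_def)
  ultimately show ?thesis
    using s by (simp add: SIZES_def sized_def s1_def s0_def SIZES_BODY_def P_def mu_def)
qed

lemma den_POWERS:
  assumes s: "sized s"
  shows "sized (den POWERS s)" "den POWERS s ''N'' 0 = n ^ mu" "den POWERS s ''K'' 0 = 2 * n * (n + 1) + 1"
proof -
  have inner: "den (LFor ''v'' ''in'' ADD_N) t ''cc'' 0 = n * t ''N'' 0"
    if t: "t ''in'' = inp" "t ''cc'' 0 = 0" for t
  proof -
    define P :: "nat \<Rightarrow> state \<Rightarrow> bool" where "P = (\<lambda>i u. u ''cc'' 0 = i * t ''N'' 0)"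
    have "P (t ''in'' 0) (den (LFor ''v'' ''in'' ADD_N) t)"
    proof (rule den_LFor_induct)
      show "P 0 (t(''v'' := (t ''v'')(0 := 0)))" using t by (simp add: P_def)
    next
      fix i u assume u: "P i u" "\<And>y. y \<noteq> ''v'' \<Longrightarrow> y \<notin> writes ADD_N \<Longrightarrow> u y = t y"
      have "u ''N'' = t ''N''" using u(2)[of "''N''"] by (simp add: ADD_N_def)
      then show "P (Suc i) ((den ADD_N u)(''v'' := (den ADD_N u ''v'')(0 := Suc i)))"
        using u(1) by (simp add: P_def ADD_N_def)
    qed (simp_all add: ADD_N_def)
    then show ?thesis using t by (simp add: P_def)
  qed
  define s0 where "s0 = s(''N'' := (s ''N'')(0 := 1))"
  define s1 where "s1 = den (LFor ''i'' ''mu'' TIMES_n) s0"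
  define s2 where "s2 = s1(''K'' := (s1 ''K'')(0 := 1))"
  define s3 where "s3 = den (LFor ''v'' ''in'' K_BODY) s2"
  define P :: "nat \<Rightarrow> state \<Rightarrow> bool" where "P = (\<lambda>i t. t ''N'' 0 = n ^ i)"
  have w: "writes TIMES_n = {''cc'', ''v'', ''N''}" by (auto simp: TIMES_n_def ADD_N_def)
  have "P (s0 ''mu'' 0) s1"
    unfolding s1_def
  proof (rule den_LFor_induct)
    show "P 0 (s0(''i'' := (s0 ''i'')(0 := 0)))" by (simp add: P_def s0_def)
  next
    fix i t assume t: "P i t" "\<And>y. y \<noteq> ''i'' \<Longrightarrow> y \<notin> writes TIMES_n \<Longrightarrow> t y = s0 y"
    have "t ''in'' = inp" using t(2)[of "''in''"] s by (simp add: w s0_def sized_def)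
    then have "den (LFor ''v'' ''in'' ADD_N) (t(''cc'' := (t ''cc'')(0 := 0))) ''cc'' 0 = n * t ''N'' 0"
      using inner[of "t(''cc'' := (t ''cc'')(0 := 0))"] by simp
    then show "P (Suc i) ((den TIMES_n t)(''i'' := (den TIMES_n t ''i'')(0 := Suc i)))"
      using t(1) by (simp add: P_def TIMES_n_def)
  qed (simp_all add: w)
  then have N: "s1 ''N'' 0 = n ^ mu" using s by (simp add: P_def s0_def sized_def)
  have in2: "s2 ''in'' = inp" using s by (simp add: s2_def s1_def s0_def den_frame w sized_def)
  define R :: "nat \<Rightarrow> state \<Rightarrow> bool" where "R = (\<lambda>i t. t ''K'' 0 = 2 * i * (n + 1) + 1)"
  have "R (s2 ''in'' 0) s3"
    unfolding s3_def
  proof (rule den_LFor_induct)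
    show "R 0 (s2(''v'' := (s2 ''v'')(0 := 0)))" by (simp add: R_def s2_def)
  next
    fix i t assume t: "R i t" "\<And>y. y \<noteq> ''v'' \<Longrightarrow> y \<notin> writes K_BODY \<Longrightarrow> t y = s2 y"
    have "t ''in'' = inp" using t(2)[of "''in''"] in2 by (simp add: K_BODY_def)
    then show "R (Suc i) ((den K_BODY t)(''v'' := (den K_BODY t ''v'')(0 := Suc i)))"
      using t(1) by (simp add: R_def K_BODY_def)
  qed (simp_all add: K_BODY_def)
  moreover have "den POWERS s = s3"
    by (simp add: POWERS_def s3_def s2_def s1_def s0_def ADD_N_def TIMES_n_def K_BODY_def)
  moreover have "s3 ''N'' = s1 ''N''" by (simp add: s3_def s2_def den_frame K_BODY_def)
  moreover have "sized s3" using s by (simp add: sized_def s3_def s2_def s1_def s0_def den_frame w K_BODY_def)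
  ultimately show "sized (den POWERS s)" "den POWERS s ''N'' 0 = n ^ mu"
    "den POWERS s ''K'' 0 = 2 * n * (n + 1) + 1"
    using N in2 by (simp_all add: R_def)
qed

lemma den_TABLES:
  assumes s: "sized s" "s ''N'' 0 = n ^ mu" "s ''K'' 0 = 2 * n * (n + 1) + 1"
  shows "env (den TABLES s)"
proof -
  define s0 where "s0 = s(''a1'' := (s ''a1'')(0 := 0))"
  define s1 where "s1 = den (LFor ''v'' ''in'' MN_BODY) s0"
  define s2 where "s2 = s1(''a1'' := (s1 ''a1'')(0 := 0), ''b1'' := (s1 ''b1'')(0 := 0))"
  define s3 where "s3 = den (LFor ''c'' ''N'' DIVMOD_BODY) s2"
  have w: "writes MN_BODY = {''mn'', ''a1''}" "writes DIVMOD_BODY = {''dv'', ''rm'', ''b1'', ''a1''}"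
    by (auto simp: MN_BODY_def DIVMOD_BODY_def)
  define P :: "nat \<Rightarrow> state \<Rightarrow> bool" where
    "P = (\<lambda>i t. t ''a1'' 0 = n * i \<and> (\<forall>u<i. t ''mn'' u = n * u))"
  have "P (s0 ''in'' 0) s1"
    unfolding s1_def
  proof (rule den_LFor_induct)
    show "P 0 (s0(''v'' := (s0 ''v'')(0 := 0)))" by (simp add: P_def s0_def)
  next
    fix i t assume t: "P i t" "t ''v'' 0 = i" "\<And>y. y \<noteq> ''v'' \<Longrightarrow> y \<notin> writes MN_BODY \<Longrightarrow> t y = s0 y"
    have "t ''in'' = inp" using t(3)[of "''in''"] s(1) by (simp add: w s0_def sized_def)
    then show "P (Suc i) ((den MN_BODY t)(''v'' := (den MN_BODY t ''v'')(0 := Suc i)))"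
      using t(1,2) by (auto simp: P_def MN_BODY_def less_Suc_eq)
  qed (simp_all add: w)
  then have mn: "\<forall>u<n. s1 ''mn'' u = n * u" using s(1) by (simp add: P_def s0_def sized_def)
  have sz2: "sized s2" "s2 ''N'' 0 = n ^ mu" "s2 ''K'' 0 = 2 * n * (n + 1) + 1"
    using s by (simp_all add: sized_def s2_def s1_def s0_def den_frame w)
  define R :: "nat \<Rightarrow> state \<Rightarrow> bool" where
    "R = (\<lambda>i t. t ''a1'' 0 = i div n \<and> t ''b1'' 0 = i mod n \<and>
       (\<forall>c<i. t ''dv'' c = c div n \<and> t ''rm'' c = c mod n))"
  have "R (s2 ''N'' 0) s3"
    unfolding s3_def
  proof (rule den_LFor_induct)
    show "R 0 (s2(''c'' := (s2 ''c'')(0 := 0)))" by (simp add: R_def s2_def)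
  next
    fix i t assume t: "R i t" "t ''c'' 0 = i" "\<And>y. y \<noteq> ''c'' \<Longrightarrow> y \<notin> writes DIVMOD_BODY \<Longrightarrow> t y = s2 y"
    have "t ''in'' = inp" using t(3)[of "''in''"] sz2(1) by (simp add: w sized_def)
    then show "R (Suc i) ((den DIVMOD_BODY t)(''c'' := (den DIVMOD_BODY t ''c'')(0 := Suc i)))"
      using t(1,2) by (auto simp: R_def DIVMOD_BODY_def less_Suc_eq div_Suc mod_Suc)
  qed (simp_all add: w)
  moreover have "den TABLES s = s3"
    by (simp add: TABLES_def s3_def s2_def s1_def s0_def MN_BODY_def DIVMOD_BODY_def)
  moreover have "s3 ''mn'' = s1 ''mn''" "s3 ''in'' = s2 ''in''" "s3 ''s'' = s2 ''s''" "s3 ''mu'' = s2 ''mu''"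
    "s3 ''N'' = s2 ''N''" "s3 ''K'' = s2 ''K''" by (simp_all add: s3_def s2_def den_frame w)
  ultimately show ?thesis using sz2 mn by (simp add: env_def R_def sized_def del: env_simps)
qed

end

section \<open>The running time\<close>

text \<open>Multiplication by a fixed number, unrolled into a sum, so that a single assignment
  computes the exponent function.\<close>

primrec times_exp :: "nat \<Rightarrow> aexp \<Rightarrow> aexp" where
  "times_exp 0 a = Num 0"
| "times_exp (Suc m) a = Plus a (times_exp m a)"

lemma aval_times_exp: "aval (times_exp m a) s = m * aval a s"
  by (induction m) auto

lemma computable_linear: "computable (\<lambda>m. D * (m + 2))"
proof -
  let ?b = "times_exp D (Plus (Read ''in'' (Num 0)) (Num 2))"
  have "halts_with (Assign ''out'' (Num 0) ?b) [m] (acost (Num 0) + acost ?b + 1) (D * (m + 2))" for m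
    unfolding halts_with_def
    using exec.Assign[of "''out''" "Num 0" ?b "input_state [m]"]
    by (intro exI conjI) (assumption, simp add: aval_times_exp input_state_def)
  then show ?thesis unfolding computable_def by blast
qed

text \<open>Three phases, because \<open>mu\<close> is written by \<open>SIZES\<close> and
  \<open>N\<close>, \<open>K\<close> by \<open>POWERS\<close> before they serve as loop bounds.
  Within each phase no loop bound is written, as \<open>exec_compile\<close> demands.
  \<open>WHOLE\<close> only adds up the time bounds.\<close>

definition PROGRAM :: com where
  "PROGRAM = Seq (compile SIZES) (Seq (compile POWERS) (compile (TABLES ;; MAIN)))"

definition WHOLE :: lcom where
  "WHOLE = SIZES ;; POWERS ;; TABLES ;; MAIN"

lemmas prog_defs = DECODE_def DECODE_BODY_def CLEAR_def INSPECT_def INSPECT_BODY_def FORCE_def FORCE_BODY_def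
  FORCE_INNER_def BIDS_def BIDS_BODY_def PASS_def PASS_BODY_def BID_RAISE_def AUCTION_def
  CLEAR_AUCTION_def COUNT_def COUNT_BODY_def TEST_def LINK_def LINK_BODY_def CLOSE_ROW_def
  CLOSE_ROW_BODY_def CLOSE_PASS_def CLOSE_def INIT_def INIT_BODY_def FINAL_def FINAL_BODY_def
  MAIN_def TABLES_def MN_BODY_def DIVMOD_BODY_def

context vcr
begin

text \<open>The sum of the values of all four loop bounds \<open>in\<close>, \<open>mu\<close>,
  \<open>N\<close> and \<open>K\<close>, hence an upper bound for each.\<close>

definition bound :: nat where
  "bound = n + mu + n ^ mu + (2 * n * (n + 1) + 1)"

text \<open>8 = 1 + 1 + 1 + 4 + 1, counting \<open>n\<close>, \<open>mu\<close>,
  \<open>n ^ mu\<close>, \<open>2 * n * (n + 1)\<close> and 1 in units of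
  \<open>n ^ (mu + 2)\<close>.\<close>

lemma bound_le: "n \<ge> 1 \<Longrightarrow> bound \<le> 8 * n ^ (mu + 2)"
proof -
  assume n: "n \<ge> 1"
  have "card S \<le> card {..<n}" using S_sub by (intro card_mono) auto
  then have "mu \<le> n" by (simp add: mu_def)
  moreover have "1 \<le> n * n" "n \<le> n * n" using n by simp_all
  moreover have "n * n \<le> n ^ (mu + 2)" using power_increasing[of 2 "mu + 2" n] n by (simp add: power2_eq_square)
  moreover have "n ^ mu \<le> n ^ (mu + 2)" using n by (intro power_increasing) auto
  moreover have "2 * n * (n + 1) = 2 * (n * n) + 2 * n" by (simp add: algebra_simps)
  ultimately show ?thesis unfolding bound_def by linarith
qed

lemma halts_with_PROGRAM:
  "\<exists>t \<le> time_bound WHOLE bound. halts_with PROGRAM (VCR_encode n E S T k) t (if reachable T then 1 else 0)"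
proof -
  define s0 where "s0 = input_state (VCR_encode n E S T k)"
  define s1 where "s1 = den SIZES s0"
  define s2 where "s2 = den POWERS s1"
  define s3 where "s3 = den TABLES s2"
  have in0: "s0 ''in'' = inp" by (simp add: s0_def inp_def)
  have sz: "sized s1" unfolding s1_def by (rule den_SIZES) (rule in0)
  note p = den_POWERS[OF sz, folded s2_def]
  have env: "env s3" using den_TABLES[OF p] by (simp add: s3_def)
  have out: "den MAIN s3 ''out'' 0 = (if reachable T then 1 else 0)" using den_MAIN[OF env] by simp
  have "\<exists>t \<le> time_bound SIZES bound. exec (compile SIZES) s0 t s1"
    unfolding s1_def by (rule exec_compile) (use in0 in \<open>auto simp: SIZES_def SIZES_BODY_def bound_def\<close>)
  then obtain t1 where t1: "t1 \<le> time_bound SIZES bound" "exec (compile SIZES) s0 t1 s1" by blast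
  have "\<exists>t \<le> time_bound POWERS bound. exec (compile POWERS) s1 t s2"
    unfolding s2_def
    by (rule exec_compile) (use sz in \<open>auto simp: POWERS_def TIMES_n_def ADD_N_def K_BODY_def sized_def bound_def\<close>)
  then obtain t2 where t2: "t2 \<le> time_bound POWERS bound" "exec (compile POWERS) s1 t2 s2" by blast
  have "\<exists>t \<le> time_bound (TABLES ;; MAIN) bound.
      exec (compile (TABLES ;; MAIN)) s2 t (den (TABLES ;; MAIN) s2)"
  proof (rule exec_compile)
    show "counters_ok (TABLES ;; MAIN)" by (simp add: prog_defs)
    have b: "bounds (TABLES ;; MAIN) = {''in'', ''mu'', ''N'', ''K''}" by (auto simp: prog_defs)
    show "bounds (TABLES ;; MAIN) \<inter> writes (TABLES ;; MAIN) = {}"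
      unfolding b by (simp add: TABLES_def MN_BODY_def DIVMOD_BODY_def MAIN_def INIT_def INIT_BODY_def
        CLOSE_def FINAL_def FINAL_BODY_def)
    show "s2 b 0 \<le> bound" if "b \<in> bounds (TABLES ;; MAIN)" for b
      using that p unfolding b by (auto simp: sized_def bound_def)
  qed
  then obtain t3 where t3: "t3 \<le> time_bound (TABLES ;; MAIN) bound"
    "exec (compile (TABLES ;; MAIN)) s2 t3 (den MAIN s3)" by (auto simp only: den.simps s3_def)
  have "exec PROGRAM s0 (t1 + (t2 + t3)) (den MAIN s3)"
    unfolding PROGRAM_def by (rule exec.Seq[OF t1(2) exec.Seq[OF t2(2) t3(2)]])
  moreover have "t1 + (t2 + t3) \<le> time_bound WHOLE bound"
    using t1(1) t2(1) t3(1) by (simp add: WHOLE_def)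
  ultimately show ?thesis unfolding halts_with_def s0_def[symmetric] using out by blast
qed

end

theorem theorem6:
  shows "\<exists>(P::com) (h::nat \<Rightarrow> nat) (C::nat). computable h \<and>
    (\<forall>(n::nat) (E::nat set set) (S::nat set) (T::nat set) (k::nat).
       VCR_instance {..<n} E S T \<and> k \<le> card S \<longrightarrow>
       (\<exists>t. halts_with P (VCR_encode n E S T k) t (if VCR_yes {..<n} E S T k then 1 else 0) \<and>
            (n \<ge> 1 \<longrightarrow> t \<le> C * n ^ h (card S - k))))"
proof -
  \<comment> \<open>\<open>K\<close> and \<open>D\<close> depend only on the program text and are
    chosen before any instance, which makes the exponent function and the constant uniform.\<close>
  obtain K D where KD: "\<And>B. B \<ge> 1 \<Longrightarrow> time_bound WHOLE B \<le> K * B ^ D"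
    using time_bound_poly by blast
  have "\<exists>t. halts_with PROGRAM (VCR_encode n E S T k) t (if VCR_yes {..<n} E S T k then 1 else 0) \<and>
      (n \<ge> 1 \<longrightarrow> t \<le> K * 8 ^ D * n ^ (D * (card S - k + 2)))"
    if inst: "VCR_instance {..<n} E S T" "k \<le> card S" for n E S T k
  proof -
    interpret vcr n E S T k by unfold_locales (use inst in auto)
    obtain t where t: "t \<le> time_bound WHOLE bound"
      "halts_with PROGRAM (VCR_encode n E S T k) t (if reachable T then 1 else 0)"
      using halts_with_PROGRAM by blast
    have "t \<le> K * 8 ^ D * n ^ (D * (card S - k + 2))" if n: "n \<ge> 1"
    proof -
      have "t \<le> K * bound ^ D" using t(1) KD[of bound] by (simp add: bound_def)
      also have "\<dots> \<le> K * (8 * n ^ (mu + 2)) ^ D"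
        using bound_le[OF n] by (intro mult_le_mono2 power_mono) auto
      also have "\<dots> = K * 8 ^ D * n ^ (D * (mu + 2))"
        by (simp only: power_mult_distrib power_mult[symmetric] mult.assoc mult.commute[of D])
      finally show ?thesis by (simp add: mu_def)
    qed
    then show ?thesis using t(2) by blast
  qed
  then show ?thesis
    by (intro exI[of _ PROGRAM] exI[of _ "\<lambda>m. D * (m + 2)"] exI[of _ "K * 8 ^ D"] conjI
        computable_linear) blast
qed

end
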